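(* Let $\mathbb{k}$ be a field, let $A$ be a commutative $\mathbb{k}$-algebra, and let $M$ be a symmetric $A$-bimodule. Let $\mathcal{A}^3(A)$ be the pre-simplicial $\mathbb{k}$-algebra, $\mathcal{B}^3(A)$ the pre-simplicial left $\mathcal{A}^3(A)$-module, and $\mathcal{M}^3(M)$ the pre-simplicial right $\mathcal{A}^3(A)$-module defined in the context. Then there is an isomorphism $$\mathrm{H}_*\big(\mathcal{M}^3(M)\otimes_{\mathcal{A}^3(A)}\mathcal{B}^3(A)\big)\;\cong\;\mathrm{H}_*^{S^3}(A,M),$$ that is, for every $n\ge 0$ the degree-$n$ homology of the chain complex associated to the pre-simplicial $\mathbb{k}$-module $\mathcal{M}^3(M)\otimes_{\mathcal{A}^3(A)}\mathcal{B}^3(A)$ is isomorphic to the degree-$n$ higher order Hochschild homology of $A$ with coefficients in $M$ over $S^3$.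
   Context: All algebras are associative and unital; $\otimes=\otimes_{\mathbb{k}}$; $\mathbb{N}$ contains $0$. For a finite set $S$, $A^{\otimes S}$ denotes the tensor product of copies of $A$ indexed by $S$ (equal to $\mathbb{k}$ if $S=\emptyset$), a commutative $\mathbb{k}$-algebra with pure tensors $\bigotimes_{s\in S}a_s$. Symmetric means $am=ma$ for all $a\in A$, $m\in M$. Empty products equal $1$. **Pre-simplicial objects.** A pre-simplicial $\mathbb{k}$-module is a family $(C_n)_{n\ge0}$ of $\mathbb{k}$-modules with $\mathbb{k}$-linear maps $\delta_i:C_n\to C_{n-1}$ ($n\geq 1$, $0\le i\le n$) satisfying $\delta_i\delta_j=\delta_{j-1}\delta_i$ for $i<j$; its associated chain complex has differential $\sum_{i=0}^n(-1)^i\delta_i$. A pre-simplicial $\mathbb{k}$-algebra $\mathcal{A}$ is the same with $\mathbb{k}$-algebras and algebra morphisms. A pre-simplicial left (right) module over $\mathcal{A}$ is a pre-simplicial $\mathbb{k}$-module $\mathcal{Y}$ with a left (right) $\mathcal{A}_n$-module structure on each $\mathcal{Y}_n$ such that $\delta_i(ay)=\delta_i(a)\delta_i(y)$ (resp. $\delta_i(ya)=\delta_i(y)\delta_i(a)$). For a pre-simplicial right module $\mathcal{X}$ and left module $\mathcal{Y}$ over $\mathcal{A}$, $\mathcal{X}\otimes_{\mathcal{A}}\mathcal{Y}$ is the pre-simplicial $\mathbb{k}$-module with $(\mathcal{X}\otimes_{\mathcal{A}}\mathcal{Y})_n=\mathcal{X}_n\otimes_{\mathcal{A}_n}\mathcal{Y}_n$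 and face maps $D_i(x\otimes y)=\delta_i(x)\otimes\delta_i(y)$. **Index sets.** For $n\ge0$ put $x_+^n=\{(j,k,l): 1\le j<k<l\le n\}$, $z_+^n=\{(j,k,l):0\le j\le k\le l\le n+1\}$, $y_+^n=\{(j,k,l)\in z_+^n: j=0\text{ or }l=n+1\text{ or }j=k\text{ or }k=l\}$. Thus $z_+^n$ is the disjoint union of $x_+^n$ and $y_+^n$, with $|x_+^n|=\frac{n(n-1)(n-2)}{6}$, $|y_+^n|=2n^2+4n+4$, $|z_+^n|=\frac{(n+2)(n+3)(n+4)}{6}$. For $n\ge1$ and $0\le i\le n$ let $s_i:\{0,\dots,n+1\}\to\{0,\dots,n\}$ be $s_i(t)=t$ if $t\le i$ and $s_i(t)=t-1$ if $t>i$ (so $i$ and $i+1$ are merged), and let $s_i(j,k,l)=(s_i(j),s_i(k),s_i(l))$. This maps $z_+^n$ to $z_+^{n-1}$ and $y_+^n$ to $y_+^{n-1}$. **The pre-simplicial algebra $\mathcal{A}^3(A)$.** $\mathcal{A}_n=A^{\otimes y_+^n}$, and $\delta_i^{\mathcal{A}}\big(\bigotimes_{p\in y_+^n}\alpha_p\big)=\bigotimes_{q\in y_+^{n-1}}\prod_{p\in y_+^n,\,s_i(p)=q}\alpha_p$. **The left module $\mathcal{B}^3(A)$.** $\mathcal{B}_n=A^{\otimes z_+^n}$, and $\delta_i^{\mathcal{B}}\big(\bigotimes_{p\in z_+^n}a_p\big)=\bigotimes_{q\in z_+^{n-1}}\prod_{p\in z_+^n,\,s_i(p)=q}a_p$.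 The element $\bigotimes_{p\in y_+^n}\alpha_p\in\mathcal{A}_n$ acts on $\bigotimes_{p\in z_+^n}a_p$ by replacing $a_p$ with $\alpha_pa_p$ for $p\in y_+^n$ and leaving $a_p$ unchanged for $p\in x_+^n$. **The right module $\mathcal{M}^3(M)$.** $\mathcal{M}_n=M$ and $\delta_i^{\mathcal{M}}=\mathrm{id}_M$ for all $n,i$, with action $m\cdot\bigotimes_{p\in y_+^n}\alpha_p=m\prod_{p\in y_+^n}\alpha_p$. **Higher order Hochschild homology over $S^3$.** For a pointed map $\varphi:V\to W$ of finite pointed sets (basepoint $*$), let $\mathcal{L}(A,M)(V)=M\otimes A^{\otimes(V\setminus\{*\})}$ and $\mathcal{L}(A,M)(\varphi)\big(m\otimes\bigotimes_{v\ne *}a_v\big)=m\,b_*\otimes\bigotimes_{w\ne *}b_w$, where $b_w=\prod_{v\neq *,\,\varphi(v)=w}a_v$. For a pointed simplicial set $\mathbf{X}_\bullet$ with finite $X_n$, $\mathrm{H}_*^{\mathbf{X}_\bullet}(A,M)$ is the homology of the complex $C_n=\mathcal{L}(A,M)(X_n)$ with differential $\sum_{i=0}^n(-1)^i\mathcal{L}(A,M)(d_i)$. $\mathrm{H}_*^{S^3}(A,M)$ is this homology for the following simplicial model $\mathbf{X}^3_\bullet$ of $S^3$ (the 3-simplex $[0123]$ with its boundary collapsed to a point): $X_n=\{*_n\}\cup\{{}_d^a\square_c^b: a,b,c,d\in\mathbb{N},\ a+b+c+d+3=n\}$ (so $X_n=\{*_n\}$ for $n\le2$), where ${}_d^a\square_c^b$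 is the $n$-simplex having $a+1,b+1,c+1,d+1$ copies of the vertices $0,1,2,3$ respectively. The face maps satisfy $d_i( *_n)=*_{n-1}$, and: - for $0\le i\le a$: $d_i({}_d^a\square_c^b)$ is obtained by lowering $a$ by one if $a\ne0$, and is $*_{n-1}$ if $a=0$; - for $a+1\le i\le a+b+1$: lower $b$ by one if $b\neq 0$, and $*_{n-1}$ if $b=0$; - for $a+b+2\le i\le a+b+c+2$: lower $c$ by one if $c\ne0$, and $*_{n-1}$ if $c=0$; - for $a+b+c+3\le i\le n$: lower $d$ by one if $d\ne0$, and $*_{n-1}$ if $d=0$. (The degeneracy maps are the evident ones and play no role in the homology.) *)

theory Defs
  imports "HOL-Algebra.Module" "HOL-Algebra.QuotRing" "HOL-Library.FuncSet"
begin

section \<open>Modules given by generators and relations\<close>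

text \<open>
  Throughout, modules over \<open>k\<close> are the modules of \<^theory>\<open>HOL-Algebra.Module\<close>.  Their record type
  also carries a multiplication and a unit, which are left undefined where only
  a module is meant.
\<close>

definition module_hom ::
    "('k, 'w) ring_scheme \<Rightarrow> ('k, 'b, 'y) module_scheme \<Rightarrow> ('k, 'c, 'z) module_scheme \<Rightarrow> ('b \<Rightarrow> 'c) set"
  where "module_hom k V W =
    {f \<in> carrier V \<rightarrow> carrier W.
       (\<forall>x \<in> carrier V. \<forall>y \<in> carrier V. f (x \<oplus>\<^bsub>V\<^esub> y) = f x \<oplus>\<^bsub>W\<^esub> f y) \<and>
       (\<forall>c \<in> carrier k. \<forall>x \<in> carrier V. f (c \<odot>\<^bsub>V\<^esub> x) = c \<odot>\<^bsub>W\<^esub> f x)}"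

definition isomorphic_modules ::
    "('k, 'w) ring_scheme \<Rightarrow> ('k, 'b, 'y) module_scheme \<Rightarrow> ('k, 'c, 'z) module_scheme \<Rightarrow> bool"
  where "isomorphic_modules k V W \<longleftrightarrow>
    (\<exists>f \<in> module_hom k V W. bij_betw f (carrier V) (carrier W))"

definition generated_submodule ::
    "('k, 'w) ring_scheme \<Rightarrow> ('k, 'c, 'z) module_scheme \<Rightarrow> 'c set \<Rightarrow> 'c set"
  where "generated_submodule k V S = \<Inter> {H. submodule H k V \<and> S \<subseteq> H}"

definition quotient_module :: "('k, 'c, 'z) module_scheme \<Rightarrow> 'c set \<Rightarrow> ('k, 'c set) module"
  where "quotient_module V U =
    \<lparr>carrier = a_rcosets\<^bsub>V\<^esub> U, mult = undefined, one = undefined, zero = U, add = set_add V,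
     smult = \<lambda>c X. \<Union>x\<in>X. U +>\<^bsub>V\<^esub> (c \<odot>\<^bsub>V\<^esub> x)\<rparr>"

definition free_module :: "('k, 'w) ring_scheme \<Rightarrow> 'x set \<Rightarrow> ('k, 'x \<Rightarrow> 'k) module"
  where "free_module k X =
    \<lparr>carrier = {f. (\<forall>x \<in> X. f x \<in> carrier k) \<and> (\<forall>x. x \<notin> X \<longrightarrow> f x = \<zero>\<^bsub>k\<^esub>) \<and>
                   finite {x. f x \<noteq> \<zero>\<^bsub>k\<^esub>}},
     mult = undefined, one = undefined, zero = (\<lambda>x. \<zero>\<^bsub>k\<^esub>),
     add = \<lambda>f g x. f x \<oplus>\<^bsub>k\<^esub> g x, smult = \<lambda>c f x. c \<otimes>\<^bsub>k\<^esub> f x\<rparr>"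

definition basis :: "('k, 'w) ring_scheme \<Rightarrow> 'x \<Rightarrow> 'x \<Rightarrow> 'k"
  where "basis k x = (\<lambda>y. if y = x then \<one>\<^bsub>k\<^esub> else \<zero>\<^bsub>k\<^esub>)"

definition presented ::
    "('k, 'w) ring_scheme \<Rightarrow> 'x set \<Rightarrow> ('x \<Rightarrow> 'k) set \<Rightarrow> ('k, ('x \<Rightarrow> 'k) set) module"
  where "presented k X rels =
    quotient_module (free_module k X) (generated_submodule k (free_module k X) rels)"

definition generator ::
    "('k, 'w) ring_scheme \<Rightarrow> 'x set \<Rightarrow> ('x \<Rightarrow> 'k) set \<Rightarrow> 'x \<Rightarrow> ('x \<Rightarrow> 'k) set"
  where "generator k X rels x =
    generated_submodule k (free_module k X) rels +>\<^bsub>free_module k X\<^esub> basis k x"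

text \<open>
  The linear map out of \<^const>\<open>presented\<close> with values in \<open>W\<close> that sends the generator
  given by \<open>x\<close> to \<open>\<phi> x\<close>, where \<open>\<phi>\<close> respects the relations: every representative \<open>f\<close> of a class \<open>C\<close>
  is sent by the linear extension of \<open>\<phi>\<close> to the same element of \<open>W\<close>.
\<close>

definition lift ::
    "('k, 'w) ring_scheme \<Rightarrow> ('k, 'c, 'z) module_scheme \<Rightarrow> ('x \<Rightarrow> 'c) \<Rightarrow> ('x \<Rightarrow> 'k) set \<Rightarrow> 'c"
  where "lift k W \<phi> C =
    the_elem ((\<lambda>f. \<Oplus>\<^bsub>W\<^esub>x \<in> {x. f x \<noteq> \<zero>\<^bsub>k\<^esub>}. f x \<odot>\<^bsub>W\<^esub> \<phi> x) ` C)"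


section \<open>Tensor products\<close>

subsection \<open>The tensor power of an algebra indexed by a set\<close>

definition tpow_rels ::
    "('k, 'w) ring_scheme \<Rightarrow> ('k, 'a, 'z) module_scheme \<Rightarrow> 's set \<Rightarrow> (('s \<Rightarrow> 'a) \<Rightarrow> 'k) set"
  where "tpow_rels k A S = (let F = free_module k (S \<rightarrow>\<^sub>E carrier A) in
    {basis k (a(s := u \<oplus>\<^bsub>A\<^esub> v)) \<ominus>\<^bsub>F\<^esub> (basis k (a(s := u)) \<oplus>\<^bsub>F\<^esub> basis k (a(s := v))) | a s u v.
       a \<in> S \<rightarrow>\<^sub>E carrier A \<and> s \<in> S \<and> u \<in> carrier A \<and> v \<in> carrier A} \<union>
    {basis k (a(s := c \<odot>\<^bsub>A\<^esub> u)) \<ominus>\<^bsub>F\<^esub> (c \<odot>\<^bsub>F\<^esub> basis k (a(s := u))) | a s c u.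
       a \<in> S \<rightarrow>\<^sub>E carrier A \<and> s \<in> S \<and> c \<in> carrier k \<and> u \<in> carrier A})"

definition tpow_module ::
    "('k, 'w) ring_scheme \<Rightarrow> ('k, 'a, 'z) module_scheme \<Rightarrow> 's set
      \<Rightarrow> ('k, (('s \<Rightarrow> 'a) \<Rightarrow> 'k) set) module"
  where "tpow_module k A S = presented k (S \<rightarrow>\<^sub>E carrier A) (tpow_rels k A S)"

definition pure ::
    "('k, 'w) ring_scheme \<Rightarrow> ('k, 'a, 'z) module_scheme \<Rightarrow> 's set
      \<Rightarrow> ('s \<Rightarrow> 'a) \<Rightarrow> (('s \<Rightarrow> 'a) \<Rightarrow> 'k) set"
  where "pure k A S a = generator k (S \<rightarrow>\<^sub>E carrier A) (tpow_rels k A S) (restrict a S)"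

definition tpow ::
    "('k, 'w) ring_scheme \<Rightarrow> ('k, 'a, 'z) module_scheme \<Rightarrow> 's set
      \<Rightarrow> ('k, (('s \<Rightarrow> 'a) \<Rightarrow> 'k) set) module"
  where "tpow k A S = (tpow_module k A S)
    \<lparr>mult := \<lambda>t u. lift k (tpow_module k A S) (\<lambda>a.
                     lift k (tpow_module k A S) (\<lambda>b. pure k A S (\<lambda>s. a s \<otimes>\<^bsub>A\<^esub> b s)) u) t,
     one := pure k A S (\<lambda>s. \<one>\<^bsub>A\<^esub>)\<rparr>"

subsection \<open>The tensor product over an algebra\<close>

text \<open>
  \<open>ra\<close> is the right action of \<open>R\<close> on \<open>X\<close> and \<open>la\<close> its left action on \<open>Y\<close>.
\<close>

definition tensor_rels ::
    "('k, 'w) ring_scheme \<Rightarrow> ('r, 'v) ring_scheme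
      \<Rightarrow> ('k, 'b, 'y) module_scheme \<Rightarrow> ('b \<Rightarrow> 'r \<Rightarrow> 'b)
      \<Rightarrow> ('k, 'c, 'z) module_scheme \<Rightarrow> ('r \<Rightarrow> 'c \<Rightarrow> 'c) \<Rightarrow> ('b \<times> 'c \<Rightarrow> 'k) set"
  where "tensor_rels k R X ra Y la = (let F = free_module k (carrier X \<times> carrier Y) in
    {basis k (x \<oplus>\<^bsub>X\<^esub> x', y) \<ominus>\<^bsub>F\<^esub> (basis k (x, y) \<oplus>\<^bsub>F\<^esub> basis k (x', y)) | x x' y.
       x \<in> carrier X \<and> x' \<in> carrier X \<and> y \<in> carrier Y} \<union>
    {basis k (x, y \<oplus>\<^bsub>Y\<^esub> y') \<ominus>\<^bsub>F\<^esub> (basis k (x, y) \<oplus>\<^bsub>F\<^esub> basis k (x, y')) | x y y'.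
       x \<in> carrier X \<and> y \<in> carrier Y \<and> y' \<in> carrier Y} \<union>
    {basis k (c \<odot>\<^bsub>X\<^esub> x, y) \<ominus>\<^bsub>F\<^esub> (c \<odot>\<^bsub>F\<^esub> basis k (x, y)) | c x y.
       c \<in> carrier k \<and> x \<in> carrier X \<and> y \<in> carrier Y} \<union>
    {basis k (x, c \<odot>\<^bsub>Y\<^esub> y) \<ominus>\<^bsub>F\<^esub> (c \<odot>\<^bsub>F\<^esub> basis k (x, y)) | c x y.
       c \<in> carrier k \<and> x \<in> carrier X \<and> y \<in> carrier Y} \<union>
    {basis k (ra x r, y) \<ominus>\<^bsub>F\<^esub> basis k (x, la r y) | x r y.
       x \<in> carrier X \<and> r \<in> carrier R \<and> y \<in> carrier Y})"

definition tensor ::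
    "('k, 'w) ring_scheme \<Rightarrow> ('r, 'v) ring_scheme
      \<Rightarrow> ('k, 'b, 'y) module_scheme \<Rightarrow> ('b \<Rightarrow> 'r \<Rightarrow> 'b)
      \<Rightarrow> ('k, 'c, 'z) module_scheme \<Rightarrow> ('r \<Rightarrow> 'c \<Rightarrow> 'c) \<Rightarrow> ('k, ('b \<times> 'c \<Rightarrow> 'k) set) module"
  where "tensor k R X ra Y la = presented k (carrier X \<times> carrier Y) (tensor_rels k R X ra Y la)"

definition tensor_elem ::
    "('k, 'w) ring_scheme \<Rightarrow> ('r, 'v) ring_scheme
      \<Rightarrow> ('k, 'b, 'y) module_scheme \<Rightarrow> ('b \<Rightarrow> 'r \<Rightarrow> 'b)
      \<Rightarrow> ('k, 'c, 'z) module_scheme \<Rightarrow> ('r \<Rightarrow> 'c \<Rightarrow> 'c) \<Rightarrow> 'b \<Rightarrow> 'c \<Rightarrow> ('b \<times> 'c \<Rightarrow> 'k) set"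
  where "tensor_elem k R X ra Y la x y =
    generator k (carrier X \<times> carrier Y) (tensor_rels k R X ra Y la) (x, y)"



section \<open>Actions of an algebra\<close>

text \<open>
  Actions are \<open>k\<close>-bilinear.  For a bimodule this makes the \<open>k\<close>-module
  structures obtained from the left and from the right action of \<open>A\<close> agree.
\<close>

definition left_action ::
    "('k, 'w) ring_scheme \<Rightarrow> ('k, 'a, 'y) module_scheme \<Rightarrow> ('k, 'm, 'z) module_scheme
      \<Rightarrow> ('a \<Rightarrow> 'm \<Rightarrow> 'm) \<Rightarrow> bool"
  where "left_action k A V la \<longleftrightarrow>
    (\<forall>a \<in> carrier A. la a \<in> module_hom k V V) \<and>
    (\<forall>v \<in> carrier V. (\<lambda>a. la a v) \<in> module_hom k A V) \<and>
    (\<forall>v \<in> carrier V. la \<one>\<^bsub>A\<^esub> v = v) \<and>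
    (\<forall>a \<in> carrier A. \<forall>b \<in> carrier A. \<forall>v \<in> carrier V. la (a \<otimes>\<^bsub>A\<^esub> b) v = la a (la b v))"

definition right_action ::
    "('k, 'w) ring_scheme \<Rightarrow> ('k, 'a, 'y) module_scheme \<Rightarrow> ('k, 'm, 'z) module_scheme
      \<Rightarrow> ('m \<Rightarrow> 'a \<Rightarrow> 'm) \<Rightarrow> bool"
  where "right_action k A V ra \<longleftrightarrow>
    (\<forall>a \<in> carrier A. (\<lambda>v. ra v a) \<in> module_hom k V V) \<and>
    (\<forall>v \<in> carrier V. ra v \<in> module_hom k A V) \<and>
    (\<forall>v \<in> carrier V. ra v \<one>\<^bsub>A\<^esub> = v) \<and>
    (\<forall>a \<in> carrier A. \<forall>b \<in> carrier A. \<forall>v \<in> carrier V. ra v (a \<otimes>\<^bsub>A\<^esub> b) = ra (ra v a) b)"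

definition bimodule ::
    "('k, 'w) ring_scheme \<Rightarrow> ('k, 'a, 'y) module_scheme \<Rightarrow> ('k, 'm, 'z) module_scheme
      \<Rightarrow> ('a \<Rightarrow> 'm \<Rightarrow> 'm) \<Rightarrow> ('m \<Rightarrow> 'a \<Rightarrow> 'm) \<Rightarrow> bool"
  where "bimodule k A M la ra \<longleftrightarrow>
    module k M \<and> left_action k A M la \<and> right_action k A M ra \<and>
    (\<forall>a \<in> carrier A. \<forall>b \<in> carrier A. \<forall>m \<in> carrier M. ra (la a m) b = la a (ra m b))"

definition symmetric_bimodule ::
    "('k, 'w) ring_scheme \<Rightarrow> ('k, 'a, 'y) module_scheme \<Rightarrow> ('k, 'm, 'z) module_scheme
      \<Rightarrow> ('a \<Rightarrow> 'm \<Rightarrow> 'm) \<Rightarrow> ('m \<Rightarrow> 'a \<Rightarrow> 'm) \<Rightarrow> bool"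
  where "symmetric_bimodule k A M la ra \<longleftrightarrow>
    bimodule k A M la ra \<and> (\<forall>a \<in> carrier A. \<forall>m \<in> carrier M. la a m = ra m a)"


section \<open>Pre-simplicial objects and their homology\<close>

text \<open>
  The records hold the data only; the axioms are the predicates that follow them.
  \<open>face C n i\<close> is the face map \<open>\<delta>\<^sub>i\<close> from degree \<open>n\<close> to degree \<open>n - 1\<close>; it is relevant only
  for \<open>n \<ge> 1\<close> and \<open>i \<le> n\<close>.
\<close>

record ('k, 'c) presimplicial =
  obj :: "nat \<Rightarrow> ('k, 'c) module"
  face :: "nat \<Rightarrow> nat \<Rightarrow> 'c \<Rightarrow> 'c"

record ('k, 'c, 'r) presimplicial_left = "('k, 'c) presimplicial" +
  lact :: "nat \<Rightarrow> 'r \<Rightarrow> 'c \<Rightarrow> 'c"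

record ('k, 'c, 'r) presimplicial_right = "('k, 'c) presimplicial" +
  ract :: "nat \<Rightarrow> 'c \<Rightarrow> 'r \<Rightarrow> 'c"

definition presimplicial_module ::
    "('k, 'w) ring_scheme \<Rightarrow> ('k, 'c, 'z) presimplicial_scheme \<Rightarrow> bool"
  where "presimplicial_module k C \<longleftrightarrow>
    (\<forall>n. module k (obj C n)) \<and>
    (\<forall>n \<ge> 1. \<forall>i \<le> n. face C n i \<in> module_hom k (obj C n) (obj C (n - 1))) \<and>
    (\<forall>n \<ge> 2. \<forall>j \<le> n. \<forall>i < j. \<forall>x \<in> carrier (obj C n).
       face C (n - 1) i (face C n j x) = face C (n - 1) (j - 1) (face C n i x))"

definition presimplicial_algebra ::
    "('k, 'w) ring_scheme \<Rightarrow> ('k, 'c, 'z) presimplicial_scheme \<Rightarrow> bool"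
  where "presimplicial_algebra k C \<longleftrightarrow>
    presimplicial_module k C \<and> (\<forall>n. algebra k (obj C n)) \<and>
    (\<forall>n \<ge> 1. \<forall>i \<le> n. face C n i \<in> ring_hom (obj C n) (obj C (n - 1)))"

definition presimplicial_left_module ::
    "('k, 'w) ring_scheme \<Rightarrow> ('k, 'r, 'y) presimplicial_scheme
      \<Rightarrow> ('k, 'c, 'r, 'z) presimplicial_left_scheme \<Rightarrow> bool"
  where "presimplicial_left_module k R Y \<longleftrightarrow>
    presimplicial_module k Y \<and> (\<forall>n. left_action k (obj R n) (obj Y n) (lact Y n)) \<and>
    (\<forall>n \<ge> 1. \<forall>i \<le> n. \<forall>a \<in> carrier (obj R n). \<forall>y \<in> carrier (obj Y n).
       face Y n i (lact Y n a y) = lact Y (n - 1) (face R n i a) (face Y n i y))"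

definition presimplicial_right_module ::
    "('k, 'w) ring_scheme \<Rightarrow> ('k, 'r, 'y) presimplicial_scheme
      \<Rightarrow> ('k, 'c, 'r, 'z) presimplicial_right_scheme \<Rightarrow> bool"
  where "presimplicial_right_module k R X \<longleftrightarrow>
    presimplicial_module k X \<and> (\<forall>n. right_action k (obj R n) (obj X n) (ract X n)) \<and>
    (\<forall>n \<ge> 1. \<forall>i \<le> n. \<forall>a \<in> carrier (obj R n). \<forall>x \<in> carrier (obj X n).
       face X n i (ract X n x a) = ract X (n - 1) (face X n i x) (face R n i a))"

definition presimplicial_tensor ::
    "('k, 'w) ring_scheme \<Rightarrow> ('k, 'r, 'v) presimplicial_scheme
      \<Rightarrow> ('k, 'b, 'r, 'y) presimplicial_right_scheme \<Rightarrow> ('k, 'c, 'r, 'z) presimplicial_left_scheme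
      \<Rightarrow> ('k, ('b \<times> 'c \<Rightarrow> 'k) set) presimplicial"
  where "presimplicial_tensor k R X Y =
    (let T = (\<lambda>n. tensor k (obj R n) (obj X n) (ract X n) (obj Y n) (lact Y n));
         t = (\<lambda>n. tensor_elem k (obj R n) (obj X n) (ract X n) (obj Y n) (lact Y n))
     in \<lparr>obj = T,
         face = \<lambda>n i. lift k (T (n - 1)) (\<lambda>(x, y). t (n - 1) (face X n i x) (face Y n i y))\<rparr>)"

definition differential ::
    "('k, 'w) ring_scheme \<Rightarrow> ('k, 'c, 'z) presimplicial_scheme \<Rightarrow> nat \<Rightarrow> 'c \<Rightarrow> 'c"
  where "differential k C n x =
    (\<Oplus>\<^bsub>obj C (n - 1)\<^esub>i \<in> {0..n}. ((\<ominus>\<^bsub>k\<^esub> \<one>\<^bsub>k\<^esub>) [^]\<^bsub>k\<^esub> i) \<odot>\<^bsub>obj C (n - 1)\<^esub> face C n i x)"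

definition cycles ::
    "('k, 'w) ring_scheme \<Rightarrow> ('k, 'c, 'z) presimplicial_scheme \<Rightarrow> nat \<Rightarrow> 'c set"
  where "cycles k C n =
    (if n = 0 then carrier (obj C 0)
     else {x \<in> carrier (obj C n). differential k C n x = \<zero>\<^bsub>obj C (n - 1)\<^esub>})"

definition boundaries ::
    "('k, 'w) ring_scheme \<Rightarrow> ('k, 'c, 'z) presimplicial_scheme \<Rightarrow> nat \<Rightarrow> 'c set"
  where "boundaries k C n = differential k C (n + 1) ` carrier (obj C (n + 1))"

definition homology ::
    "('k, 'w) ring_scheme \<Rightarrow> ('k, 'c, 'z) presimplicial_scheme \<Rightarrow> nat \<Rightarrow> ('k, 'c set) module"
  where "homology k C n =
    quotient_module ((obj C n)\<lparr>carrier := cycles k C n\<rparr>) (boundaries k C n)"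


section \<open>The objects \<open>\<A>\<^sup>3(A)\<close>, \<open>\<B>\<^sup>3(A)\<close> and \<open>\<M>\<^sup>3(M)\<close>\<close>

definition x_plus :: "nat \<Rightarrow> (nat \<times> nat \<times> nat) set"
  where "x_plus n = {(j, k, l). 1 \<le> j \<and> j < k \<and> k < l \<and> l \<le> n}"

definition z_plus :: "nat \<Rightarrow> (nat \<times> nat \<times> nat) set"
  where "z_plus n = {(j, k, l). 0 \<le> j \<and> j \<le> k \<and> k \<le> l \<and> l \<le> n + 1}"

definition y_plus :: "nat \<Rightarrow> (nat \<times> nat \<times> nat) set"
  where "y_plus n = {(j, k, l). (j, k, l) \<in> z_plus n \<and> (j = 0 \<or> l = n + 1 \<or> j = k \<or> k = l)}"

definition merge :: "nat \<Rightarrow> nat \<Rightarrow> nat"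
  where "merge i t = (if t \<le> i then t else t - 1)"

definition merge3 :: "nat \<Rightarrow> nat \<times> nat \<times> nat \<Rightarrow> nat \<times> nat \<times> nat"
  where "merge3 i = (\<lambda>(j, k, l). (merge i j, merge i k, merge i l))"

definition fibre_prod ::
    "('k, 'a, 'z) module_scheme \<Rightarrow> 's set \<Rightarrow> ('s \<Rightarrow> 't) \<Rightarrow> ('s \<Rightarrow> 'a) \<Rightarrow> 't \<Rightarrow> 'a"
  where "fibre_prod A S f a t = (\<Otimes>\<^bsub>A\<^esub>s \<in> {s \<in> S. f s = t}. a s)"

definition tpow_map ::
    "('k, 'w) ring_scheme \<Rightarrow> ('k, 'a, 'z) module_scheme \<Rightarrow> 's set \<Rightarrow> 't set \<Rightarrow> ('s \<Rightarrow> 't)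
      \<Rightarrow> (('s \<Rightarrow> 'a) \<Rightarrow> 'k) set \<Rightarrow> (('t \<Rightarrow> 'a) \<Rightarrow> 'k) set"
  where "tpow_map k A S T f = lift k (tpow k A T) (\<lambda>a. pure k A T (fibre_prod A S f a))"

type_synonym ('k, 'a) tpow3 = "((nat \<times> nat \<times> nat \<Rightarrow> 'a) \<Rightarrow> 'k) set"

definition A3 ::
    "('k, 'w) ring_scheme \<Rightarrow> ('k, 'a, 'z) module_scheme \<Rightarrow> ('k, ('k, 'a) tpow3) presimplicial"
  where "A3 k A =
    \<lparr>obj = \<lambda>n. tpow k A (y_plus n),
     face = \<lambda>n i. tpow_map k A (y_plus n) (y_plus (n - 1)) (merge3 i)\<rparr>"

definition B3 ::
    "('k, 'w) ring_scheme \<Rightarrow> ('k, 'a, 'z) module_scheme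
      \<Rightarrow> ('k, ('k, 'a) tpow3, ('k, 'a) tpow3) presimplicial_left"
  where "B3 k A =
    \<lparr>obj = \<lambda>n. tpow k A (z_plus n),
     face = \<lambda>n i. tpow_map k A (z_plus n) (z_plus (n - 1)) (merge3 i),
     lact = \<lambda>n t u. lift k (tpow k A (z_plus n)) (\<lambda>\<alpha>.
                      lift k (tpow k A (z_plus n)) (\<lambda>a.
                        pure k A (z_plus n) (\<lambda>p. if p \<in> y_plus n then \<alpha> p \<otimes>\<^bsub>A\<^esub> a p else a p)) u) t\<rparr>"

definition M3 ::
    "('k, 'w) ring_scheme \<Rightarrow> ('k, 'a, 'z) module_scheme \<Rightarrow> ('k, 'm) module \<Rightarrow> ('m \<Rightarrow> 'a \<Rightarrow> 'm)
      \<Rightarrow> ('k, 'm, ('k, 'a) tpow3) presimplicial_right"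
  where "M3 k A M ra =
    \<lparr>obj = \<lambda>n. M,
     face = \<lambda>n i m. m,
     ract = \<lambda>n m t. lift k M (\<lambda>\<alpha>. ra m (\<Otimes>\<^bsub>A\<^esub>p \<in> y_plus n. \<alpha> p)) t\<rparr>"


section \<open>Higher order Hochschild homology\<close>

text \<open>
  The homology of a pointed simplicial set only involves its simplices and its
  face maps, so the degeneracies are not recorded.
\<close>

record 'v pointed_presimplicial_set =
  simplices :: "nat \<Rightarrow> 'v set"
  base :: "nat \<Rightarrow> 'v"
  sface :: "nat \<Rightarrow> nat \<Rightarrow> 'v \<Rightarrow> 'v"

definition loday ::
    "('k, 'w) ring_scheme \<Rightarrow> ('k, 'a, 'z) module_scheme \<Rightarrow> ('k, 'm) module
      \<Rightarrow> 'v set \<Rightarrow> 'v \<Rightarrow> ('k, ('m \<times> (('v \<Rightarrow> 'a) \<Rightarrow> 'k) set \<Rightarrow> 'k) set) module"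
  where "loday k A M V v0 =
    tensor k k M (\<lambda>m c. c \<odot>\<^bsub>M\<^esub> m) (tpow k A (V - {v0})) (\<lambda>c t. c \<odot>\<^bsub>tpow k A (V - {v0})\<^esub> t)"

definition loday_elem ::
    "('k, 'w) ring_scheme \<Rightarrow> ('k, 'a, 'z) module_scheme \<Rightarrow> ('k, 'm) module
      \<Rightarrow> 'v set \<Rightarrow> 'v \<Rightarrow> 'm \<Rightarrow> (('v \<Rightarrow> 'a) \<Rightarrow> 'k) set
      \<Rightarrow> ('m \<times> (('v \<Rightarrow> 'a) \<Rightarrow> 'k) set \<Rightarrow> 'k) set"
  where "loday_elem k A M V v0 =
    tensor_elem k k M (\<lambda>m c. c \<odot>\<^bsub>M\<^esub> m) (tpow k A (V - {v0})) (\<lambda>c t. c \<odot>\<^bsub>tpow k A (V - {v0})\<^esub> t)"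

definition loday_map ::
    "('k, 'w) ring_scheme \<Rightarrow> ('k, 'a, 'z) module_scheme \<Rightarrow> ('k, 'm) module \<Rightarrow> ('m \<Rightarrow> 'a \<Rightarrow> 'm)
      \<Rightarrow> 'v set \<Rightarrow> 'v \<Rightarrow> 'u set \<Rightarrow> 'u \<Rightarrow> ('v \<Rightarrow> 'u)
      \<Rightarrow> ('m \<times> (('v \<Rightarrow> 'a) \<Rightarrow> 'k) set \<Rightarrow> 'k) set \<Rightarrow> ('m \<times> (('u \<Rightarrow> 'a) \<Rightarrow> 'k) set \<Rightarrow> 'k) set"
  where "loday_map k A M ra V v0 W w0 \<phi> =
    lift k (loday k A M W w0) (\<lambda>(m, t).
      lift k (loday k A M W w0) (\<lambda>a.
        let b = fibre_prod A (V - {v0}) \<phi> a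
        in loday_elem k A M W w0 (ra m (b w0)) (pure k A (W - {w0}) b)) t)"

definition hochschild_complex ::
    "('k, 'w) ring_scheme \<Rightarrow> ('k, 'a, 'z) module_scheme \<Rightarrow> ('k, 'm) module \<Rightarrow> ('m \<Rightarrow> 'a \<Rightarrow> 'm)
      \<Rightarrow> 'v pointed_presimplicial_set
      \<Rightarrow> ('k, ('m \<times> (('v \<Rightarrow> 'a) \<Rightarrow> 'k) set \<Rightarrow> 'k) set) presimplicial"
  where "hochschild_complex k A M ra X =
    \<lparr>obj = \<lambda>n. loday k A M (simplices X n) (base X n),
     face = \<lambda>n i. loday_map k A M ra (simplices X n) (base X n)
                    (simplices X (n - 1)) (base X (n - 1)) (sface X n i)\<rparr>"

definition higher_hochschild_homology ::
    "('k, 'w) ring_scheme \<Rightarrow> ('k, 'a, 'z) module_scheme \<Rightarrow> ('k, 'm) module \<Rightarrow> ('m \<Rightarrow> 'a \<Rightarrow> 'm)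
      \<Rightarrow> 'v pointed_presimplicial_set \<Rightarrow> nat
      \<Rightarrow> ('k, ('m \<times> (('v \<Rightarrow> 'a) \<Rightarrow> 'k) set \<Rightarrow> 'k) set set) module"
  where "higher_hochschild_homology k A M ra X n = homology k (hochschild_complex k A M ra X) n"

text \<open>
  \<open>Base n\<close> is the degenerate simplex \<open>*\<^sub>n\<close>.  \<open>Box a b c d\<close> has \<open>a + 1\<close>, \<open>b + 1\<close>,
  \<open>c + 1\<close>, \<open>d + 1\<close> copies of the vertices \<open>0\<close>, \<open>1\<close>, \<open>2\<close>, \<open>3\<close> of the 3-simplex.
\<close>

datatype simplex3 = Base nat | Box nat nat nat nat

definition X3_face :: "nat \<Rightarrow> nat \<Rightarrow> simplex3 \<Rightarrow> simplex3"
  where "X3_face n i \<sigma> = (case \<sigma> of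
      Base m \<Rightarrow> Base (n - 1)
    | Box a b c d \<Rightarrow>
        if i \<le> a then (if a \<noteq> 0 then Box (a - 1) b c d else Base (n - 1))
        else if i \<le> a + b + 1 then (if b \<noteq> 0 then Box a (b - 1) c d else Base (n - 1))
        else if i \<le> a + b + c + 2 then (if c \<noteq> 0 then Box a b (c - 1) d else Base (n - 1))
        else (if d \<noteq> 0 then Box a b c (d - 1) else Base (n - 1)))"

definition X3 :: "simplex3 pointed_presimplicial_set"
  where "X3 =
    \<lparr>simplices = \<lambda>n. {Base n} \<union> {Box a b c d | a b c d. a + b + c + d + 3 = n},
     base = Base,
     sface = X3_face\<rparr>"

end

theory Submission
  imports Defs
begin

text \<open>
  Moving the \<open>y\<^sub>+\<close>-entries of a tensor across \<open>\<otimes>\<close> over \<open>\<A>\<^sub>n\<close> gives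
  \<open>\<M>\<^sub>n \<otimes> \<B>\<^sub>n \<cong> M \<otimes> A\<^bsup>\<otimes>x\<^esup>\<close> with \<open>x = x\<^sub>+\<close>, and \<open>x\<^sub>+\<close> is in bijection with the simplices of \<open>X\<^sup>3\<^sub>n\<close> other
  than the base point.  More uniformly, let \<open>\<pi>\<close> be the map from \<open>z\<^sub>+\<close> to the \<open>n\<close>-simplices that
  collapses \<open>y\<^sub>+\<close> to the base point and is this bijection on \<open>x\<^sub>+\<close>; the isomorphism is the map that
  the Loday construction attaches to \<open>\<pi>\<close>.  It commutes with the faces because
  \<open>\<pi> \<circ> s\<^sub>i = d\<^sub>i \<circ> \<pi>\<close> and products over fibres are functorial.
\<close>

section \<open>Linear maps\<close>

text \<open>Every map out of a tensor product is a \<open>lift\<close>, whose value is meaningful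
  only if the given data respect the relations. Most of the work is therefore well-definedness; once
  two maps are known to be linear, their equality is checked on pure tensors.

  The awkward case is the face map of the relative tensor product, whose balancedness would directly
  call for compatibility of both actions with the faces. It is obtained by pulling back along the
  comparison map instead: in the lower degree that map is injective, and after applying it the
  balancing identity reduces to the fact that the indices in \<open>Y\<close> end up at the base
  point.

  The inverse inserts units at the indices in \<open>Y\<close>. It comes from the same recipe as
  everything else, a product over fibres, because an empty fibre contributes 1.\<close>

lemma module_homI:
  assumes "\<And>x. x \<in> carrier V \<Longrightarrow> f x \<in> carrier W"
    and "\<And>x y. x \<in> carrier V \<Longrightarrow> y \<in> carrier V \<Longrightarrow> f (x \<oplus>\<^bsub>V\<^esub> y) = f x \<oplus>\<^bsub>W\<^esub> f y"
    and "\<And>c x. c \<in> carrier k \<Longrightarrow> x \<in> carrier V \<Longrightarrow> f (c \<odot>\<^bsub>V\<^esub> x) = c \<odot>\<^bsub>W\<^esub> f x"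
  shows "f \<in> module_hom k V W"
  using assms by (auto simp: module_hom_def)

lemma
  assumes "f \<in> module_hom k V W"
  shows module_hom_closed: "x \<in> carrier V \<Longrightarrow> f x \<in> carrier W"
    and module_hom_add: "x \<in> carrier V \<Longrightarrow> y \<in> carrier V \<Longrightarrow> f (x \<oplus>\<^bsub>V\<^esub> y) = f x \<oplus>\<^bsub>W\<^esub> f y"
    and module_hom_smult: "c \<in> carrier k \<Longrightarrow> x \<in> carrier V \<Longrightarrow> f (c \<odot>\<^bsub>V\<^esub> x) = c \<odot>\<^bsub>W\<^esub> f x"
  using assms by (auto simp: module_hom_def)

text \<open>Maps such as \<open>lift\<close> are controlled only on carriers, so linearity has to
  transfer along equality there. The module hypothesis on \<open>V\<close> supplies closure of the
  carrier, which allows the replacement at sums and multiples.\<close>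

lemma module_hom_cong:
  assumes "\<And>x. x \<in> carrier V \<Longrightarrow> f x = g x" "module k V"
  shows "f \<in> module_hom k V W \<longleftrightarrow> g \<in> module_hom k V W"
proof -
  interpret V: module k V by fact
  have "g \<in> module_hom k V W" if "f \<in> module_hom k V W" "\<And>x. x \<in> carrier V \<Longrightarrow> f x = g x" for f g
  proof -
    note f = that(1) and eq = that(2)[symmetric]
    show ?thesis
      by (rule module_homI)
        (simp_all add: eq module_hom_closed[OF f] module_hom_add[OF f] module_hom_smult[OF f])
  qed
  from this[of f g] this[of g f] assms show ?thesis by auto
qed

lemma module_hom_compose:
  assumes "f \<in> module_hom k V W" "g \<in> module_hom k W U"
  shows "(\<lambda>x. g (f x)) \<in> module_hom k V U"
  using assms by (auto simp: module_hom_def Pi_iff)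

lemma module_hom_ident: "(\<lambda>x. x) \<in> module_hom k V V"
  by (auto simp: module_hom_def)

lemma module_hom_zero:
  assumes "module k V" "module k W" "f \<in> module_hom k V W"
  shows "f \<zero>\<^bsub>V\<^esub> = \<zero>\<^bsub>W\<^esub>"
proof -
  interpret V: module k V by fact
  interpret W: module k W by fact
  \<comment> \<open>Writing the zero vector as a multiple by the scalar 0 reduces the claim to
    compatibility with scalars.\<close>
  have "f \<zero>\<^bsub>V\<^esub> = f (\<zero>\<^bsub>k\<^esub> \<odot>\<^bsub>V\<^esub> \<zero>\<^bsub>V\<^esub>)" by simp
  also have "\<dots> = \<zero>\<^bsub>W\<^esub>"
    using module_hom_smult[OF assms(3), of "\<zero>\<^bsub>k\<^esub>" "\<zero>\<^bsub>V\<^esub>"] module_hom_closed[OF assms(3)] by simp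
  finally show ?thesis .
qed

lemma module_hom_minus:
  assumes "module k V" "module k W" "f \<in> module_hom k V W" "x \<in> carrier V" "y \<in> carrier V"
  shows "f (x \<ominus>\<^bsub>V\<^esub> y) = f x \<ominus>\<^bsub>W\<^esub> f y"
proof -
  interpret V: module k V by fact
  interpret W: module k W by fact
  have "f (\<ominus>\<^bsub>V\<^esub> y) \<oplus>\<^bsub>W\<^esub> f y = \<zero>\<^bsub>W\<^esub>"
    using module_hom_add[OF assms(3), of "\<ominus>\<^bsub>V\<^esub> y" y] module_hom_zero[OF assms(1-3)] assms(5)
    by (simp add: V.M.l_neg)
  then have "f (\<ominus>\<^bsub>V\<^esub> y) = \<ominus>\<^bsub>W\<^esub> f y"
    using assms(5) module_hom_closed[OF assms(3)] by (simp add: W.M.minus_equality)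
  then show ?thesis
    using module_hom_add[OF assms(3), of x "\<ominus>\<^bsub>V\<^esub> y"] assms(4,5) by (simp add: a_minus_def)
qed

lemma module_hom_finsum:
  assumes "module k V" "module k W" "f \<in> module_hom k V W" "finite I" "v \<in> I \<rightarrow> carrier V"
  shows "f (\<Oplus>\<^bsub>V\<^esub>i\<in>I. v i) = (\<Oplus>\<^bsub>W\<^esub>i\<in>I. f (v i))"
  using assms(4,5)
proof (induction I rule: finite_induct)
  case empty
  interpret V: module k V by fact
  interpret W: module k W by fact
  show ?case using module_hom_zero[OF assms(1-3)] by simp
next
  case (insert i I)
  interpret V: module k V by fact
  interpret W: module k W by fact
  have "(\<lambda>i. f (v i)) \<in> insert i I \<rightarrow> carrier W"
    using insert.prems module_hom_closed[OF assms(3)] by auto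
  then show ?case
    using insert module_hom_add[OF assms(3), of "v i" "\<Oplus>\<^bsub>V\<^esub>i\<in>I. v i"]
    by (simp add: Pi_iff)
qed

lemma module_hom_const_zero:
  assumes "module k W"
  shows "(\<lambda>x. \<zero>\<^bsub>W\<^esub>) \<in> module_hom k V W"
proof -
  interpret W: module k W by fact
  show ?thesis by (simp add: module_hom_def)
qed

lemma module_hom_pointwise_add:
  assumes "module k W" "f \<in> module_hom k V W" "g \<in> module_hom k V W"
  shows "(\<lambda>x. f x \<oplus>\<^bsub>W\<^esub> g x) \<in> module_hom k V W"
proof -
  interpret W: module k W by fact
  note f = assms(2) and g = assms(3)
  show ?thesis
    by (rule module_homI)
      (simp_all add: module_hom_closed[OF f] module_hom_add[OF f] module_hom_smult[OF f]
        module_hom_closed[OF g] module_hom_add[OF g] module_hom_smult[OF g]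
        W.M.a_ac W.smult_r_distr)
qed

lemma module_hom_pointwise_smult:
  assumes "module k W" "c \<in> carrier k" "f \<in> module_hom k V W"
  shows "(\<lambda>x. c \<odot>\<^bsub>W\<^esub> f x) \<in> module_hom k V W"
proof -
  interpret W: module k W by fact
  note f = assms(3)
  show ?thesis
  proof (rule module_homI)
    fix d x assume "d \<in> carrier k" "x \<in> carrier V"
    then show "c \<odot>\<^bsub>W\<^esub> f (d \<odot>\<^bsub>V\<^esub> x) = d \<odot>\<^bsub>W\<^esub> (c \<odot>\<^bsub>W\<^esub> f x)"
      using assms(2) module_hom_closed[OF f]
      by (simp add: module_hom_smult[OF f] W.R.m_comm flip: W.smult_assoc1)
  qed (simp_all add: module_hom_closed[OF f] module_hom_add[OF f] assms(2) W.smult_r_distr)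
qed


section \<open>Quotient modules\<close>

lemma (in module) submodule_abelian_subgroup:
  assumes "submodule H R M"
  shows "abelian_subgroup H M"
  using submodule.axioms(1)[OF assms] M.abelian_group_axioms
  by (simp add: abelian_subgroupI3 additive_subgroup.intro)

context module
begin

context
  fixes H
  assumes H: "submodule H R M"
begin

interpretation H: abelian_subgroup H M
  using H by (rule submodule_abelian_subgroup)

lemma quotient_carrier: "carrier (quotient_module M H) = {H +>\<^bsub>M\<^esub> x | x. x \<in> carrier M}"
  by (auto simp: quotient_module_def A_RCOSETS_def' )

lemma quotient_zero: "\<zero>\<^bsub>quotient_module M H\<^esub> = H +>\<^bsub>M\<^esub> \<zero>\<^bsub>M\<^esub>"
  using H.a_subset by (simp add: quotient_module_def)

lemma quotient_add:
  assumes "x \<in> carrier M" "y \<in> carrier M"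
  shows "(H +>\<^bsub>M\<^esub> x) \<oplus>\<^bsub>quotient_module M H\<^esub> (H +>\<^bsub>M\<^esub> y) = H +>\<^bsub>M\<^esub> (x \<oplus>\<^bsub>M\<^esub> y)"
  using assms by (simp add: quotient_module_def H.a_rcos_sum)

text \<open>The definition takes a union over all representatives \<open>y\<close> of the coset.
  Since \<open>H\<close> is stable under scalars, each of them contributes the same coset, and the
  union collapses.\<close>

lemma quotient_smult:
  assumes "c \<in> carrier R" "x \<in> carrier M"
  shows "c \<odot>\<^bsub>quotient_module M H\<^esub> (H +>\<^bsub>M\<^esub> x) = H +>\<^bsub>M\<^esub> (c \<odot>\<^bsub>M\<^esub> x)"
proof -
  have "H +>\<^bsub>M\<^esub> (c \<odot>\<^bsub>M\<^esub> y) = H +>\<^bsub>M\<^esub> (c \<odot>\<^bsub>M\<^esub> x)" if y: "y \<in> H +>\<^bsub>M\<^esub> x" for y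
  proof -
    obtain h where h: "h \<in> H" "y = h \<oplus>\<^bsub>M\<^esub> x"
      using y by (auto simp: a_r_coset_def')
    have "h \<in> carrier M" using h H.a_subset by auto
    then have "c \<odot>\<^bsub>M\<^esub> y = (c \<odot>\<^bsub>M\<^esub> h) \<oplus>\<^bsub>M\<^esub> (c \<odot>\<^bsub>M\<^esub> x)"
      using h assms by (simp add: smult_r_distr)
    moreover have "c \<odot>\<^bsub>M\<^esub> h \<in> H"
      using submoduleE(4)[OF H] assms h by auto
    ultimately have "c \<odot>\<^bsub>M\<^esub> y \<in> H +>\<^bsub>M\<^esub> (c \<odot>\<^bsub>M\<^esub> x)"
      by (auto simp: a_r_coset_def')
    from H.a_repr_independence'[OF this smult_closed[OF assms]] show ?thesis ..
  qed
  \<comment> \<open>The index set of the union is nonempty; otherwise the union would be empty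
    instead of the common value.\<close>
  moreover have "x \<in> H +>\<^bsub>M\<^esub> x"
    using assms H.a_rcos_self by auto
  ultimately have "(\<Union>y \<in> H +>\<^bsub>M\<^esub> x. H +>\<^bsub>M\<^esub> (c \<odot>\<^bsub>M\<^esub> y)) = H +>\<^bsub>M\<^esub> (c \<odot>\<^bsub>M\<^esub> x)"
    by blast
  then show ?thesis
    by (simp add: quotient_module_def)
qed

lemma quotient_is_module: "module R (quotient_module M H)"
proof (rule moduleI)
  show "cring R" ..
  show "abelian_group (quotient_module M H)"
  proof (rule abelian_groupI)
    fix X assume "X \<in> carrier (quotient_module M H)"
    then obtain x where x: "x \<in> carrier M" "X = H +>\<^bsub>M\<^esub> x" by (auto simp: quotient_carrier)
    then have "(H +>\<^bsub>M\<^esub> (\<ominus>\<^bsub>M\<^esub> x)) \<oplus>\<^bsub>quotient_module M H\<^esub> X = \<zero>\<^bsub>quotient_module M H\<^esub>"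
      unfolding quotient_zero by (simp add: quotient_add M.l_neg)
    moreover have "H +>\<^bsub>M\<^esub> (\<ominus>\<^bsub>M\<^esub> x) \<in> carrier (quotient_module M H)"
      using x by (auto simp: quotient_carrier)
    ultimately show "\<exists>Y \<in> carrier (quotient_module M H). Y \<oplus>\<^bsub>quotient_module M H\<^esub> X = \<zero>\<^bsub>quotient_module M H\<^esub>"
      by blast
  next
    show "\<zero>\<^bsub>quotient_module M H\<^esub> \<in> carrier (quotient_module M H)"
      unfolding quotient_zero quotient_carrier by blast
  next
    fix X assume "X \<in> carrier (quotient_module M H)"
    then show "\<zero>\<^bsub>quotient_module M H\<^esub> \<oplus>\<^bsub>quotient_module M H\<^esub> X = X"
      unfolding quotient_zero quotient_carrier by (auto simp: quotient_add)
  qed (auto simp: quotient_carrier quotient_add M.a_ac)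
qed (auto simp: quotient_carrier quotient_add quotient_smult smult_l_distr smult_r_distr smult_assoc1)

end

end


section \<open>Free modules and presentations\<close>

lemma free_module_simps [simp]:
  "add (free_module k X) = (\<lambda>f g x. f x \<oplus>\<^bsub>k\<^esub> g x)"
  "smult (free_module k X) = (\<lambda>c f x. c \<otimes>\<^bsub>k\<^esub> f x)"
  "zero (free_module k X) = (\<lambda>x. \<zero>\<^bsub>k\<^esub>)"
  by (simp_all add: free_module_def)

lemma in_free_module_iff:
  "f \<in> carrier (free_module k X) \<longleftrightarrow>
    (\<forall>x \<in> X. f x \<in> carrier k) \<and> (\<forall>x. x \<notin> X \<longrightarrow> f x = \<zero>\<^bsub>k\<^esub>) \<and> finite {x. f x \<noteq> \<zero>\<^bsub>k\<^esub>}"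
  by (simp add: free_module_def)

lemma (in cring) free_module_closed: "f \<in> carrier (free_module R X) \<Longrightarrow> f x \<in> carrier R"
  by (cases "x \<in> X") (auto simp: in_free_module_iff)

lemma (in cring) free_module_is_module: "module R (free_module R X)"
proof -
  have cl: "\<forall>x. f x \<in> carrier R" if "f \<in> carrier (free_module R X)" for f
    using free_module_closed[OF that] by simp
  show ?thesis
proof (rule moduleI)
  have fin: "finite {x. f x \<oplus> g x \<noteq> \<zero>}"
    if "f \<in> carrier (free_module R X)" "g \<in> carrier (free_module R X)" for f g
    by (rule finite_subset[of _ "{x. f x \<noteq> \<zero>} \<union> {x. g x \<noteq> \<zero>}"])
      (use that in \<open>auto simp: in_free_module_iff\<close>)
  show "abelian_group (free_module R X)"
  proof (rule abelian_groupI)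
    fix f assume f: "f \<in> carrier (free_module R X)"
    let ?g = "\<lambda>x. \<ominus> f x"
    have "{x. ?g x \<noteq> \<zero>} = {x. f x \<noteq> \<zero>}"
      using cl[OF f] by auto
    then have "?g \<in> carrier (free_module R X)"
      using f by (simp add: in_free_module_iff)
    moreover have "?g \<oplus>\<^bsub>free_module R X\<^esub> f = \<zero>\<^bsub>free_module R X\<^esub>"
      using cl[OF f] by (simp add: l_neg)
    ultimately show "\<exists>g \<in> carrier (free_module R X). g \<oplus>\<^bsub>free_module R X\<^esub> f = \<zero>\<^bsub>free_module R X\<^esub>"
      by blast
  next
    fix f g assume "f \<in> carrier (free_module R X)" "g \<in> carrier (free_module R X)"
    then show "f \<oplus>\<^bsub>free_module R X\<^esub> g \<in> carrier (free_module R X)"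
      using fin[of f g] by (simp add: in_free_module_iff)
  next
    show "\<zero>\<^bsub>free_module R X\<^esub> \<in> carrier (free_module R X)"
      by (simp add: in_free_module_iff)
  qed (simp_all add: fun_eq_iff cl a_ac)
  fix c f assume "c \<in> carrier R" "f \<in> carrier (free_module R X)"
  moreover have "finite {x. c \<otimes> f x \<noteq> \<zero>}"
    by (rule finite_subset[of _ "{x. f x \<noteq> \<zero>}"])
      (use \<open>c \<in> carrier R\<close> \<open>f \<in> carrier (free_module R X)\<close> in \<open>auto simp: in_free_module_iff\<close>)
  ultimately show "c \<odot>\<^bsub>free_module R X\<^esub> f \<in> carrier (free_module R X)"
    by (simp add: in_free_module_iff)
qed (simp_all add: fun_eq_iff l_distr r_distr m_assoc is_cring cl)
qed

lemma (in cring) basis_in_free_module: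
  assumes "x \<in> X"
  shows "basis R x \<in> carrier (free_module R X)"
  by (auto simp: in_free_module_iff basis_def assms intro: finite_subset[of _ "{x}"])

text \<open>Induction on a finite set containing the support: splitting off \<open>f s\<close> times
  the basis element at \<open>s\<close> leaves a function supported in the smaller set.\<close>

lemma (in cring) free_module_induct [consumes 1, case_names zero basis add smult]:
  assumes "f \<in> carrier (free_module R X)"
    and "Q (\<lambda>x. \<zero>)"
    and "\<And>x. x \<in> X \<Longrightarrow> Q (basis R x)"
    and "\<And>f g. f \<in> carrier (free_module R X) \<Longrightarrow> g \<in> carrier (free_module R X) \<Longrightarrow>
      Q f \<Longrightarrow> Q g \<Longrightarrow> Q (\<lambda>x. f x \<oplus> g x)"
    and "\<And>c f. c \<in> carrier R \<Longrightarrow> f \<in> carrier (free_module R X) \<Longrightarrow> Q f \<Longrightarrow> Q (\<lambda>x. c \<otimes> f x)"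
  shows "Q f"
proof -
  interpret F: module R "free_module R X" by (rule free_module_is_module)
  have "finite S \<Longrightarrow> \<forall>f \<in> carrier (free_module R X). {x. f x \<noteq> \<zero>} \<subseteq> S \<longrightarrow> Q f" for S
  proof (induction S rule: finite_induct)
    case empty
    have "f = (\<lambda>x. \<zero>)" if "{x. f x \<noteq> \<zero>} \<subseteq> {}" for f :: "'c \<Rightarrow> 'a"
      using that by auto
    then show ?case using assms(2) by metis
  next
    case (insert s S)
    show ?case
    proof (intro ballI impI)
      fix f assume f: "f \<in> carrier (free_module R X)" "{x. f x \<noteq> \<zero>} \<subseteq> insert s S"
      show "Q f"
      proof (cases "s \<in> X")
        case True
        have fin: "finite {x. (f(s := \<zero>)) x \<noteq> \<zero>}"
          by (rule finite_subset[of _ "{x. f x \<noteq> \<zero>}"]) (use f in \<open>auto simp: in_free_module_iff\<close>)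
        have g: "f(s := \<zero>) \<in> carrier (free_module R X)"
          using f fin by (auto simp: in_free_module_iff)
        have b: "basis R s \<in> carrier (free_module R X)"
          using True by (rule basis_in_free_module)
        have fs: "f s \<in> carrier R" using f(1) by (rule free_module_closed)
        have "Q (\<lambda>x. (f(s := \<zero>)) x \<oplus> f s \<otimes> basis R s x)"
        proof (rule assms(4)[OF g])
          show "(\<lambda>x. f s \<otimes> basis R s x) \<in> carrier (free_module R X)"
            using F.smult_closed[OF fs b] by simp
          have "{x. (f(s := \<zero>)) x \<noteq> \<zero>} \<subseteq> S" using f(2) by auto
          then show "Q (f(s := \<zero>))" using insert.IH g by blast
          show "Q (\<lambda>x. f s \<otimes> basis R s x)" using assms(3)[OF True] assms(5)[OF fs b] by blast
        qed
        moreover have "(\<lambda>x. (f(s := \<zero>)) x \<oplus> f s \<otimes> basis R s x) = f"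
          using free_module_closed[OF f(1)] by (auto simp: basis_def fun_eq_iff)
        ultimately show ?thesis by simp
      next
        case False
        then have "f s = \<zero>" using f by (auto simp: in_free_module_iff)
        then show ?thesis using insert.IH f by auto
      qed
    qed
  qed
  from this[of "{x. f x \<noteq> \<zero>}"] assms(1) show ?thesis
    by (auto simp: in_free_module_iff)
qed

text \<open>Names the sum inside \<open>lift\<close>, so that \<open>lift\<close> becomes
  \<open>the_elem\<close> of the image of a coset under this function.\<close>

definition linear_extension ::
    "('k, 'w) ring_scheme \<Rightarrow> ('k, 'c, 'z) module_scheme \<Rightarrow> ('x \<Rightarrow> 'c) \<Rightarrow> ('x \<Rightarrow> 'k) \<Rightarrow> 'c"
  where "linear_extension k W \<phi> f = (\<Oplus>\<^bsub>W\<^esub>x \<in> {x. f x \<noteq> \<zero>\<^bsub>k\<^esub>}. f x \<odot>\<^bsub>W\<^esub> \<phi> x)"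

context module
begin

text \<open>The sum in \<open>linear_extension\<close> runs over the support of \<open>f\<close>,
  which changes under addition and scaling. Enlarging it to a finite subset of \<open>X\<close> lets
  several functions be summed over a common index set.\<close>

lemma linear_extension_eq:
  assumes "\<phi> \<in> X \<rightarrow> carrier M" "f \<in> carrier (free_module R X)"
    and "finite S" "{x. f x \<noteq> \<zero>\<^bsub>R\<^esub>} \<subseteq> S" "S \<subseteq> X"
  shows "linear_extension R M \<phi> f = (\<Oplus>\<^bsub>M\<^esub>x\<in>S. f x \<odot>\<^bsub>M\<^esub> \<phi> x)"
  unfolding linear_extension_def
proof (rule M.add.finprod_mono_neutral_cong_left)
  show "f x \<odot>\<^bsub>M\<^esub> \<phi> x = \<zero>\<^bsub>M\<^esub>" if "x \<in> S - {x. f x \<noteq> \<zero>\<^bsub>R\<^esub>}" for x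
  proof -
    have "\<phi> x \<in> carrier M" "f x = \<zero>\<^bsub>R\<^esub>" using that assms by auto
    then show ?thesis by simp
  qed
  show "(\<lambda>x. f x \<odot>\<^bsub>M\<^esub> \<phi> x) \<in> S \<rightarrow> carrier M"
    using assms(1,5) R.free_module_closed[OF assms(2)] by blast
qed (use assms in auto)

lemma linear_extension_hom:
  assumes "\<phi> \<in> X \<rightarrow> carrier M"
  shows "linear_extension R M \<phi> \<in> module_hom R (free_module R X) M"
proof (rule module_homI)
  have supp: "finite {x. f x \<noteq> \<zero>\<^bsub>R\<^esub>} \<and> {x. f x \<noteq> \<zero>\<^bsub>R\<^esub>} \<subseteq> X"
    if "f \<in> carrier (free_module R X)" for f
    using that by (auto simp: in_free_module_iff)
  interpret F: module R "free_module R X" by (rule R.free_module_is_module)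
  have cl: "(\<lambda>x. f x \<odot>\<^bsub>M\<^esub> \<phi> x) \<in> S \<rightarrow> carrier M"
    if "f \<in> carrier (free_module R X)" "S \<subseteq> X" for f S
    using that assms R.free_module_closed[OF that(1)] by auto
  {
    fix f assume f: "f \<in> carrier (free_module R X)"
    show "linear_extension R M \<phi> f \<in> carrier M"
      unfolding linear_extension_def by (rule M.finsum_closed) (use cl f supp in blast)
  }
  {
    fix f g assume f: "f \<in> carrier (free_module R X)" and g: "g \<in> carrier (free_module R X)"
    let ?S = "{x. f x \<noteq> \<zero>\<^bsub>R\<^esub>} \<union> {x. g x \<noteq> \<zero>\<^bsub>R\<^esub>}"
    have S: "finite ?S" "?S \<subseteq> X" using supp[OF f] supp[OF g] by auto
    have "{x. f x \<oplus>\<^bsub>R\<^esub> g x \<noteq> \<zero>\<^bsub>R\<^esub>} \<subseteq> ?S" by auto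
    then have "linear_extension R M \<phi> (f \<oplus>\<^bsub>free_module R X\<^esub> g)
        = (\<Oplus>\<^bsub>M\<^esub>x\<in>?S. (f x \<oplus>\<^bsub>R\<^esub> g x) \<odot>\<^bsub>M\<^esub> \<phi> x)"
      using linear_extension_eq[OF assms F.a_closed[OF f g] S(1)] S(2) by simp
    also have "\<dots> = (\<Oplus>\<^bsub>M\<^esub>x\<in>?S. f x \<odot>\<^bsub>M\<^esub> \<phi> x \<oplus>\<^bsub>M\<^esub> g x \<odot>\<^bsub>M\<^esub> \<phi> x)"
    proof (rule M.finsum_cong'[OF refl])
      fix x assume "x \<in> ?S"
      then have "\<phi> x \<in> carrier M" using S assms by auto
      then show "(f x \<oplus>\<^bsub>R\<^esub> g x) \<odot>\<^bsub>M\<^esub> \<phi> x = f x \<odot>\<^bsub>M\<^esub> \<phi> x \<oplus>\<^bsub>M\<^esub> g x \<odot>\<^bsub>M\<^esub> \<phi> x"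
        using R.free_module_closed[OF f] R.free_module_closed[OF g] by (simp add: smult_l_distr)
    qed (use cl[OF f S(2)] cl[OF g S(2)] in auto)
    also have "\<dots> = (\<Oplus>\<^bsub>M\<^esub>x\<in>?S. f x \<odot>\<^bsub>M\<^esub> \<phi> x) \<oplus>\<^bsub>M\<^esub> (\<Oplus>\<^bsub>M\<^esub>x\<in>?S. g x \<odot>\<^bsub>M\<^esub> \<phi> x)"
      by (rule M.finsum_addf[OF cl[OF f S(2)] cl[OF g S(2)]])
    also have "\<dots> = linear_extension R M \<phi> f \<oplus>\<^bsub>M\<^esub> linear_extension R M \<phi> g"
      using linear_extension_eq[OF assms f S(1)] linear_extension_eq[OF assms g S(1)] S(2) by simp
    finally show "linear_extension R M \<phi> (f \<oplus>\<^bsub>free_module R X\<^esub> g)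
        = linear_extension R M \<phi> f \<oplus>\<^bsub>M\<^esub> linear_extension R M \<phi> g" .
  }
  {
    fix c f assume c: "c \<in> carrier R" and f: "f \<in> carrier (free_module R X)"
    let ?S = "{x. f x \<noteq> \<zero>\<^bsub>R\<^esub>}"
    have S: "finite ?S" "?S \<subseteq> X" using supp[OF f] by auto
    have "{x. c \<otimes>\<^bsub>R\<^esub> f x \<noteq> \<zero>\<^bsub>R\<^esub>} \<subseteq> ?S" using c by auto
    then have "linear_extension R M \<phi> (c \<odot>\<^bsub>free_module R X\<^esub> f)
        = (\<Oplus>\<^bsub>M\<^esub>x\<in>?S. (c \<otimes>\<^bsub>R\<^esub> f x) \<odot>\<^bsub>M\<^esub> \<phi> x)"
      using linear_extension_eq[OF assms F.smult_closed[OF c f] S(1)] S(2) by simp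
    also have "\<dots> = (\<Oplus>\<^bsub>M\<^esub>x\<in>?S. c \<odot>\<^bsub>M\<^esub> (f x \<odot>\<^bsub>M\<^esub> \<phi> x))"
    proof (rule M.finsum_cong'[OF refl])
      fix x assume "x \<in> ?S"
      then have "\<phi> x \<in> carrier M" using S assms by auto
      then show "(c \<otimes>\<^bsub>R\<^esub> f x) \<odot>\<^bsub>M\<^esub> \<phi> x = c \<odot>\<^bsub>M\<^esub> (f x \<odot>\<^bsub>M\<^esub> \<phi> x)"
        using R.free_module_closed[OF f] c by (simp add: smult_assoc1)
    qed (use cl[OF f S(2)] c in auto)
    also have "\<dots> = c \<odot>\<^bsub>M\<^esub> linear_extension R M \<phi> f"
      unfolding linear_extension_def by (rule finsum_smult_ldistr[OF S(1) c cl[OF f S(2)], symmetric])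
    finally show "linear_extension R M \<phi> (c \<odot>\<^bsub>free_module R X\<^esub> f)
        = c \<odot>\<^bsub>M\<^esub> linear_extension R M \<phi> f" .
  }
qed

lemma linear_extension_basis:
  assumes "\<phi> \<in> X \<rightarrow> carrier M" "x \<in> X"
  shows "linear_extension R M \<phi> (basis R x) = \<phi> x"
proof -
  have "linear_extension R M \<phi> (basis R x) = (\<Oplus>\<^bsub>M\<^esub>y\<in>{x}. basis R x y \<odot>\<^bsub>M\<^esub> \<phi> y)"
    by (rule linear_extension_eq[OF assms(1) R.basis_in_free_module[OF assms(2)]])
      (use assms in \<open>auto simp: basis_def\<close>)
  also have "\<dots> = \<phi> x"
    using assms by (simp add: basis_def Pi_iff)
  finally show ?thesis .
qed

end

section \<open>Generated submodules and kernels\<close>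

context module
begin

lemma generated_submodule_is_submodule:
  assumes "S \<subseteq> carrier M"
  shows "submodule (generated_submodule R M S) R M"
proof (rule submoduleI)
  \<comment> \<open>The carrier belongs to the family being intersected, so that family is nonempty
    and the intersection stays inside the module.\<close>
  have sub: "submodule (carrier M) R M" by (rule carrier_is_submodule)
  show "generated_submodule R M S \<subseteq> carrier M"
    using assms sub by (auto simp: generated_submodule_def)
  show "\<zero>\<^bsub>M\<^esub> \<in> generated_submodule R M S"
    using submodule.axioms(1) subgroup.one_closed by (fastforce simp: generated_submodule_def)
qed (auto simp: generated_submodule_def submoduleE)

lemma generated_submodule_incl: "S \<subseteq> generated_submodule R M S"
  by (auto simp: generated_submodule_def)

lemma generated_submodule_least:
  assumes "submodule H R M" "S \<subseteq> H"
  shows "generated_submodule R M S \<subseteq> H"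
  using assms by (auto simp: generated_submodule_def)

end

lemma module_hom_kernel_submodule:
  assumes "module k V" "module k W" "f \<in> module_hom k V W"
  shows "submodule {x \<in> carrier V. f x = \<zero>\<^bsub>W\<^esub>} k V"
proof -
  interpret V: module k V by fact
  interpret W: module k W by fact
  note f = assms(3)
  have "f (\<ominus>\<^bsub>V\<^esub> x) = \<zero>\<^bsub>W\<^esub>" if "x \<in> carrier V" "f x = \<zero>\<^bsub>W\<^esub>" for x
  proof -
    have "\<ominus>\<^bsub>V\<^esub> x = \<zero>\<^bsub>V\<^esub> \<ominus>\<^bsub>V\<^esub> x" using that by (simp add: a_minus_def)
    then show ?thesis
      using module_hom_minus[OF assms, of "\<zero>\<^bsub>V\<^esub>" x] module_hom_zero[OF assms] that
      by (simp add: a_minus_def)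
  qed
  then show ?thesis
    by (intro V.submoduleI)
      (auto simp: module_hom_zero[OF assms] module_hom_add[OF f] module_hom_smult[OF f])
qed

section \<open>Universal property of a presented module\<close>

definition respects_rels ::
    "('k, 'w) ring_scheme \<Rightarrow> ('k, 'c, 'z) module_scheme \<Rightarrow> 'x set \<Rightarrow> ('x \<Rightarrow> 'k) set \<Rightarrow> ('x \<Rightarrow> 'c) \<Rightarrow> bool"
  where "respects_rels k W X rels \<phi> \<longleftrightarrow>
    \<phi> \<in> X \<rightarrow> carrier W \<and> (\<forall>r \<in> rels. linear_extension k W \<phi> r = \<zero>\<^bsub>W\<^esub>)"

locale presentation = cring k for k :: "('k, 'w) ring_scheme" +
  fixes X :: "'x set" and rels :: "('x \<Rightarrow> 'k) set"
  assumes rels_subset: "rels \<subseteq> carrier (free_module k X)"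
begin

sublocale F: module k "free_module k X"
  by (rule free_module_is_module)

abbreviation "N \<equiv> generated_submodule k (free_module k X) rels"

lemma N_submodule: "submodule N k (free_module k X)"
  by (rule F.generated_submodule_is_submodule[OF rels_subset])

sublocale N: abelian_subgroup N "free_module k X"
  by (rule F.submodule_abelian_subgroup[OF N_submodule])

lemma presented_is_module: "module k (presented k X rels)"
  unfolding presented_def by (rule F.quotient_is_module[OF N_submodule])

lemma coset_hom: "(\<lambda>f. N +>\<^bsub>free_module k X\<^esub> f) \<in> module_hom k (free_module k X) (presented k X rels)"
  unfolding presented_def
  by (rule module_homI)
    (auto simp: F.quotient_carrier[OF N_submodule] F.quotient_add[OF N_submodule]
      F.quotient_smult[OF N_submodule] simp del: free_module_simps)

lemma generator_closed: "x \<in> X \<Longrightarrow> generator k X rels x \<in> carrier (presented k X rels)"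
  unfolding generator_def by (rule module_hom_closed[OF coset_hom basis_in_free_module])

text \<open>The form in which a defining relation becomes an equation between classes:
  \<open>f\<close> differs from \<open>g\<close> by an element of \<open>N\<close>.\<close>

lemma coset_eqI:
  assumes "f \<ominus>\<^bsub>free_module k X\<^esub> g \<in> rels" "f \<in> carrier (free_module k X)" "g \<in> carrier (free_module k X)"
  shows "N +>\<^bsub>free_module k X\<^esub> f = N +>\<^bsub>free_module k X\<^esub> g"
proof -
  have "f = (f \<ominus>\<^bsub>free_module k X\<^esub> g) \<oplus>\<^bsub>free_module k X\<^esub> g"
    using assms(2,3) by (simp add: F.M.minus_eq F.M.a_assoc F.M.l_neg del: free_module_simps)
  then have "f \<in> N +>\<^bsub>free_module k X\<^esub> g"
    unfolding a_r_coset_def' using assms(1) F.generated_submodule_incl by blast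
  from N.a_repr_independence'[OF this assms(3)] show ?thesis ..
qed

text \<open>Every class has a representative in the free module and the coset map is linear, so
  induction on finite combinations of basis elements descends to the quotient.\<close>

lemma presented_induct [consumes 1, case_names zero generator add smult]:
  assumes "t \<in> carrier (presented k X rels)"
    and zero: "Q \<zero>\<^bsub>presented k X rels\<^esub>"
    and gen: "\<And>x. x \<in> X \<Longrightarrow> Q (generator k X rels x)"
    and add: "\<And>t u. t \<in> carrier (presented k X rels) \<Longrightarrow> u \<in> carrier (presented k X rels) \<Longrightarrow>
      Q t \<Longrightarrow> Q u \<Longrightarrow> Q (t \<oplus>\<^bsub>presented k X rels\<^esub> u)"
    and smult: "\<And>c t. c \<in> carrier k \<Longrightarrow> t \<in> carrier (presented k X rels) \<Longrightarrow> Q t \<Longrightarrow>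
      Q (c \<odot>\<^bsub>presented k X rels\<^esub> t)"
  shows "Q t"
proof -
  obtain f where f: "f \<in> carrier (free_module k X)" "t = N +>\<^bsub>free_module k X\<^esub> f"
    using assms(1) by (auto simp: presented_def F.quotient_carrier[OF N_submodule])
  note cl = module_hom_closed[OF coset_hom]
  from f(1) have "Q (N +>\<^bsub>free_module k X\<^esub> f)"
  proof (induction rule: free_module_induct)
    case zero
    show ?case
      using module_hom_zero[OF F.module_axioms presented_is_module coset_hom] assms(2) by simp
  next
    case (basis x)
    then show ?case using gen by (simp add: generator_def)
  next
    case (add f g)
    have "Q ((N +>\<^bsub>free_module k X\<^esub> f) \<oplus>\<^bsub>presented k X rels\<^esub> (N +>\<^bsub>free_module k X\<^esub> g))"
      using add by (intro assms(4) cl)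
    then show ?case
      using module_hom_add[OF coset_hom add.hyps] by simp
  next
    case (smult c f)
    have "Q (c \<odot>\<^bsub>presented k X rels\<^esub> (N +>\<^bsub>free_module k X\<^esub> f))"
      using smult by (intro assms(5) cl)
    then show ?case
      using module_hom_smult[OF coset_hom smult.hyps] by simp
  qed
  then show ?thesis using f by simp
qed

lemma presented_hom_eqI:
  assumes "module k W" "f \<in> module_hom k (presented k X rels) W" "g \<in> module_hom k (presented k X rels) W"
    and "\<And>x. x \<in> X \<Longrightarrow> f (generator k X rels x) = g (generator k X rels x)"
    and "t \<in> carrier (presented k X rels)"
  shows "f t = g t"
  using assms(5)
proof (induction rule: presented_induct)
  case zero
  show ?case
    by (simp add: module_hom_zero[OF presented_is_module assms(1) assms(2)]
        module_hom_zero[OF presented_is_module assms(1) assms(3)])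
qed (use assms(4) in \<open>simp_all add: module_hom_add[OF assms(2)] module_hom_add[OF assms(3)]
    module_hom_smult[OF assms(2)] module_hom_smult[OF assms(3)]\<close>)

context
  fixes W :: "('k, 'c, 'z) module_scheme" and \<phi>
  assumes W: "module k W" and \<phi>: "respects_rels k W X rels \<phi>"
begin

interpretation W: module k W by (rule W)

text \<open>The kernel of the linear extension is a submodule containing the relations, hence it
  contains \<open>N\<close>. So the extension is constant on each coset, and \<open>the_elem\<close>
  in \<open>lift\<close> is applied to a singleton.\<close>

lemma lift_coset:
  assumes "f \<in> carrier (free_module k X)"
  shows "lift k W \<phi> (N +>\<^bsub>free_module k X\<^esub> f) = linear_extension k W \<phi> f"
proof -
  have hom: "linear_extension k W \<phi> \<in> module_hom k (free_module k X) W"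
    using \<phi> by (intro W.linear_extension_hom) (auto simp: respects_rels_def)
  have "N \<subseteq> {f \<in> carrier (free_module k X). linear_extension k W \<phi> f = \<zero>\<^bsub>W\<^esub>}"
    by (rule F.generated_submodule_least[OF module_hom_kernel_submodule[OF F.module_axioms W hom]])
      (use rels_subset \<phi> in \<open>auto simp: respects_rels_def\<close>)
  then have N: "h \<in> carrier (free_module k X)" "linear_extension k W \<phi> h = \<zero>\<^bsub>W\<^esub>" if "h \<in> N" for h
    using that by auto
  have "linear_extension k W \<phi> g = linear_extension k W \<phi> f"
    if "g \<in> N +>\<^bsub>free_module k X\<^esub> f" for g
  proof -
    from that obtain h where "h \<in> N" "g = h \<oplus>\<^bsub>free_module k X\<^esub> f"
      unfolding a_r_coset_def' by blast
    then show ?thesis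
      using assms by (simp only: module_hom_add[OF hom] N W.M.l_zero module_hom_closed[OF hom])
  qed
  moreover have "f \<in> N +>\<^bsub>free_module k X\<^esub> f"
    using assms by (rule N.a_rcos_self)
  ultimately have "linear_extension k W \<phi> ` (N +>\<^bsub>free_module k X\<^esub> f) = {linear_extension k W \<phi> f}"
    by blast
  then show ?thesis
    unfolding lift_def linear_extension_def[symmetric] by simp
qed

lemma lift_generator:
  assumes "x \<in> X"
  shows "lift k W \<phi> (generator k X rels x) = \<phi> x"
  using \<phi> assms unfolding generator_def
  by (subst lift_coset) (auto simp: respects_rels_def basis_in_free_module W.linear_extension_basis)

lemma lift_hom: "lift k W \<phi> \<in> module_hom k (presented k X rels) W"
proof -
  have hom: "linear_extension k W \<phi> \<in> module_hom k (free_module k X) W"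
    using \<phi> by (intro W.linear_extension_hom) (auto simp: respects_rels_def)
  have car: "carrier (presented k X rels) = {N +>\<^bsub>free_module k X\<^esub> f | f. f \<in> carrier (free_module k X)}"
    by (simp add: presented_def F.quotient_carrier[OF N_submodule])
  show ?thesis
  proof (rule module_homI)
    fix t u assume "t \<in> carrier (presented k X rels)" "u \<in> carrier (presented k X rels)"
    then obtain f g where fg: "f \<in> carrier (free_module k X)" "t = N +>\<^bsub>free_module k X\<^esub> f"
      "g \<in> carrier (free_module k X)" "u = N +>\<^bsub>free_module k X\<^esub> g"
      by (auto simp: car)
    then show "lift k W \<phi> (t \<oplus>\<^bsub>presented k X rels\<^esub> u) = lift k W \<phi> t \<oplus>\<^bsub>W\<^esub> lift k W \<phi> u"
      by (simp only: lift_coset F.a_closed module_hom_add[OF hom] module_hom_add[OF coset_hom, symmetric])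
  next
    fix c t assume c: "c \<in> carrier k" and "t \<in> carrier (presented k X rels)"
    then obtain f where f: "f \<in> carrier (free_module k X)" "t = N +>\<^bsub>free_module k X\<^esub> f"
      by (auto simp: car)
    then show "lift k W \<phi> (c \<odot>\<^bsub>presented k X rels\<^esub> t) = c \<odot>\<^bsub>W\<^esub> lift k W \<phi> t"
      using c by (simp only: lift_coset F.smult_closed module_hom_smult[OF hom]
          module_hom_smult[OF coset_hom, symmetric])
  qed (auto simp: car lift_coset module_hom_closed[OF hom])
qed

end

text \<open>Serves maps of two variables in which one variable is a parameter inside a
  \<open>lift\<close>: linearity in the parameter can be read off on generators. It propagates to
  every \<open>t\<close> because linear maps are closed under sums and scalar multiples.\<close>

lemma lift_parametric_hom:
  assumes "module k V" "module k W"
    and "\<And>v. v \<in> carrier V \<Longrightarrow> respects_rels k W X rels (\<Phi> v)"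
    and "\<And>x. x \<in> X \<Longrightarrow> (\<lambda>v. \<Phi> v x) \<in> module_hom k V W"
    and "t \<in> carrier (presented k X rels)"
  shows "(\<lambda>v. lift k W (\<Phi> v) t) \<in> module_hom k V W"
  using assms(5)
proof (induction rule: presented_induct)
  note hom = lift_hom[OF assms(2,3)]
  \<comment> \<open>The \<open>lift\<close> of \<open>\<Phi> v\<close> is known to be linear only
    for \<open>v\<close> in the carrier of \<open>V\<close>, so each case yields an equality there,
    which this congruence turns into membership.\<close>
  note cong = module_hom_cong[OF _ assms(1), THEN iffD1, rotated]
  {
    case zero
    show ?case
      by (rule cong[OF module_hom_const_zero[OF assms(2)]])
        (simp add: module_hom_zero[OF presented_is_module assms(2) hom])
  next
    case (generator x)
    show ?case
      by (rule cong[OF assms(4)[OF generator]]) (simp add: lift_generator[OF assms(2,3)] generator)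
  next
    case (add t u)
    show ?case
      by (rule cong[OF module_hom_pointwise_add[OF assms(2) add.IH]])
        (simp add: module_hom_add[OF hom] add.hyps)
  next
    case (smult c t)
    show ?case
      by (rule cong[OF module_hom_pointwise_smult[OF assms(2) smult.hyps(1) smult.IH]])
        (simp add: module_hom_smult[OF hom] smult.hyps)
  }
qed

end


section \<open>Tensor products over an algebra\<close>

definition balanced ::
    "('k, 'w) ring_scheme \<Rightarrow> ('r, 'v) ring_scheme
      \<Rightarrow> ('k, 'b, 'y) module_scheme \<Rightarrow> ('b \<Rightarrow> 'r \<Rightarrow> 'b)
      \<Rightarrow> ('k, 'c, 'z) module_scheme \<Rightarrow> ('r \<Rightarrow> 'c \<Rightarrow> 'c)
      \<Rightarrow> ('k, 'd, 'u) module_scheme \<Rightarrow> ('b \<Rightarrow> 'c \<Rightarrow> 'd) \<Rightarrow> bool"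
  where "balanced k R X ra Y la W \<beta> \<longleftrightarrow>
    (\<forall>y \<in> carrier Y. (\<lambda>x. \<beta> x y) \<in> module_hom k X W) \<and>
    (\<forall>x \<in> carrier X. \<beta> x \<in> module_hom k Y W) \<and>
    (\<forall>x \<in> carrier X. \<forall>r \<in> carrier R. \<forall>y \<in> carrier Y. \<beta> (ra x r) y = \<beta> x (la r y))"

text \<open>The closure assumptions place the relations inside the free module. The locale serves
  both the tensor products over \<open>k\<close>, where \<open>R\<close> is \<open>k\<close> acting
  by scalars, and those over a tensor power of \<open>A\<close>.\<close>

locale tensor_product = X: module k X + Y: module k Y
  for k :: "('k, 'w) ring_scheme" and R :: "('r, 'v) ring_scheme"
    and X :: "('k, 'b, 'y) module_scheme" and ra :: "'b \<Rightarrow> 'r \<Rightarrow> 'b"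
    and Y :: "('k, 'c, 'z) module_scheme" and la :: "'r \<Rightarrow> 'c \<Rightarrow> 'c" +
  assumes ra_closed: "x \<in> carrier X \<Longrightarrow> r \<in> carrier R \<Longrightarrow> ra x r \<in> carrier X"
    and la_closed: "r \<in> carrier R \<Longrightarrow> y \<in> carrier Y \<Longrightarrow> la r y \<in> carrier Y"
begin

abbreviation "XY \<equiv> carrier X \<times> carrier Y"
abbreviation "rels \<equiv> tensor_rels k R X ra Y la"
abbreviation "T \<equiv> tensor k R X ra Y la"
abbreviation "tens \<equiv> tensor_elem k R X ra Y la"

sublocale F: module k "free_module k XY"
  by (rule X.R.free_module_is_module)

sublocale presentation k XY rels
proof
  show "rels \<subseteq> carrier (free_module k XY)"
    unfolding tensor_rels_def Let_def
    by (auto simp: X.R.basis_in_free_module ra_closed la_closed simp del: free_module_simps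
        intro!: F.M.minus_closed)
qed

lemma tensor_is_module: "module k T"
  using presented_is_module by (simp add: tensor_def)

lemma balanced_respects_rels:
  fixes W :: "('k, 'd, 'u) module_scheme"
  assumes "module k W" "balanced k R X ra Y la W \<beta>"
  shows "respects_rels k W XY rels (case_prod \<beta>)"
proof -
  interpret W: module k W by fact
  let ?F = "free_module k XY" and ?e = "linear_extension k W (case_prod \<beta>)"
  have left: "(\<lambda>x. \<beta> x y) \<in> module_hom k X W" if "y \<in> carrier Y" for y
    using assms(2) that by (auto simp: balanced_def)
  have right: "\<beta> x \<in> module_hom k Y W" if "x \<in> carrier X" for x
    using assms(2) that by (auto simp: balanced_def)
  have mid: "\<beta> (ra x r) y = \<beta> x (la r y)" if "x \<in> carrier X" "r \<in> carrier R" "y \<in> carrier Y" for x r y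
    using assms(2) that by (auto simp: balanced_def)
  have \<beta>: "case_prod \<beta> \<in> XY \<rightarrow> carrier W"
    using module_hom_closed[OF right] by auto
  have hom: "?e \<in> module_hom k ?F W"
    by (rule W.linear_extension_hom[OF \<beta>])
  note e_basis [simp] = W.linear_extension_basis[OF \<beta>]
  have b [simp]: "basis k (x, y) \<in> carrier ?F" if "x \<in> carrier X" "y \<in> carrier Y" for x y
    using that by (simp add: X.R.basis_in_free_module)
  note [simp] = module_hom_closed[OF right] ra_closed la_closed
    module_hom_minus[OF F.module_axioms assms(1) hom] module_hom_add[OF hom] module_hom_smult[OF hom]
  have "?e r = \<zero>\<^bsub>W\<^esub>" if "r \<in> rels" for r
    using that unfolding tensor_rels_def Let_def
    by (elim UnE CollectE exE conjE)
      (simp_all add: module_hom_add[OF left] module_hom_smult[OF left]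
        module_hom_add[OF right] module_hom_smult[OF right] mid W.M.r_neg a_minus_def[of W]
        del: free_module_simps)
  with \<beta> show ?thesis by (simp add: respects_rels_def)
qed

text \<open>Each of the five families in \<open>tensor_rels\<close> gives one identity between
  classes through \<open>coset_eqI\<close>; together with linearity of the coset map they make up
  \<open>balanced\<close>.\<close>

lemma tens_balanced: "balanced k R X ra Y la T tens"
proof -
  let ?F = "free_module k XY" and ?q = "\<lambda>f. N +>\<^bsub>free_module k XY\<^esub> f"
  interpret T: module k T by (rule tensor_is_module)
  have hom: "?q \<in> module_hom k ?F T"
    using coset_hom by (simp add: tensor_def)
  have b [simp]: "basis k (x, y) \<in> carrier ?F" if "x \<in> carrier X" "y \<in> carrier Y" for x y
    using that by (simp add: X.R.basis_in_free_module)
  have tens: "tens x y = ?q (basis k (x, y))" for x y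
    by (simp add: tensor_elem_def generator_def)
  have *: "?q (basis k (x \<oplus>\<^bsub>X\<^esub> x', y)) = ?q (basis k (x, y) \<oplus>\<^bsub>?F\<^esub> basis k (x', y))"
    if "x \<in> carrier X" "x' \<in> carrier X" "y \<in> carrier Y" for x x' y
    by (insert that, rule coset_eqI, unfold tensor_rels_def Let_def, blast)
      (simp_all del: free_module_simps)
  have **: "?q (basis k (x, y \<oplus>\<^bsub>Y\<^esub> y')) = ?q (basis k (x, y) \<oplus>\<^bsub>?F\<^esub> basis k (x, y'))"
    if "x \<in> carrier X" "y \<in> carrier Y" "y' \<in> carrier Y" for x y y'
    by (insert that, rule coset_eqI, unfold tensor_rels_def Let_def, blast)
      (simp_all del: free_module_simps)
  have ***: "?q (basis k (c \<odot>\<^bsub>X\<^esub> x, y)) = ?q (c \<odot>\<^bsub>?F\<^esub> basis k (x, y))"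
    if "c \<in> carrier k" "x \<in> carrier X" "y \<in> carrier Y" for c x y
    by (insert that, rule coset_eqI, unfold tensor_rels_def Let_def, blast)
      (simp_all del: free_module_simps)
  have ****: "?q (basis k (x, c \<odot>\<^bsub>Y\<^esub> y)) = ?q (c \<odot>\<^bsub>?F\<^esub> basis k (x, y))"
    if "c \<in> carrier k" "x \<in> carrier X" "y \<in> carrier Y" for c x y
    by (insert that, rule coset_eqI, unfold tensor_rels_def Let_def, blast)
      (simp_all del: free_module_simps)
  have *****: "?q (basis k (ra x r, y)) = ?q (basis k (x, la r y))"
    if "x \<in> carrier X" "r \<in> carrier R" "y \<in> carrier Y" for x r y
    by (insert that, rule coset_eqI, unfold tensor_rels_def Let_def, blast)
      (simp_all add: ra_closed la_closed del: free_module_simps)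
  note [simp] = module_hom_closed[OF hom] module_hom_add[OF hom] module_hom_smult[OF hom]
  show ?thesis
    unfolding balanced_def tens
    by (intro conjI ballI module_homI)
      (simp_all add: * ** *** **** ***** del: free_module_simps)
qed

context
  fixes W :: "('k, 'd, 'u) module_scheme" and \<beta>
  assumes W: "module k W" and \<beta>: "balanced k R X ra Y la W \<beta>"
begin

lemma lift_tensor_hom: "lift k W (\<lambda>(x, y). \<beta> x y) \<in> module_hom k T W"
  using lift_hom[OF W balanced_respects_rels[OF W \<beta>]] by (simp add: tensor_def)

lemma lift_tensor_elem:
  assumes "x \<in> carrier X" "y \<in> carrier Y"
  shows "lift k W (\<lambda>(x, y). \<beta> x y) (tens x y) = \<beta> x y"
  using lift_generator[OF W balanced_respects_rels[OF W \<beta>], of "(x, y)"] assms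
  by (simp add: tensor_elem_def)

end

lemma tensor_hom_eqI:
  assumes "module k W" "f \<in> module_hom k T W" "g \<in> module_hom k T W"
    and "\<And>x y. x \<in> carrier X \<Longrightarrow> y \<in> carrier Y \<Longrightarrow> f (tens x y) = g (tens x y)"
    and "t \<in> carrier T"
  shows "f t = g t"
  by (rule presented_hom_eqI[OF assms(1)])
    (use assms(2-5) in \<open>auto simp: tensor_def tensor_elem_def\<close>)

end


section \<open>Tensor powers of an algebra\<close>

text \<open>Linearity in a slot is expressed by updating the family at \<open>s\<close>, the shape
  in which \<open>tpow_rels\<close> states its relations.\<close>

definition multilinear ::
    "('k, 'w) ring_scheme \<Rightarrow> ('k, 'a, 'z) module_scheme \<Rightarrow> 's set
      \<Rightarrow> ('k, 'c, 'y) module_scheme \<Rightarrow> (('s \<Rightarrow> 'a) \<Rightarrow> 'c) \<Rightarrow> bool"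
  where "multilinear k A S W \<phi> \<longleftrightarrow>
    \<phi> \<in> (S \<rightarrow>\<^sub>E carrier A) \<rightarrow> carrier W \<and>
    (\<forall>a \<in> S \<rightarrow>\<^sub>E carrier A. \<forall>s \<in> S. (\<lambda>u. \<phi> (a(s := u))) \<in> module_hom k A W)"

lemma tpow_simps [simp]:
  "carrier (tpow k A S) = carrier (tpow_module k A S)"
  "add (tpow k A S) = add (tpow_module k A S)"
  "zero (tpow k A S) = zero (tpow_module k A S)"
  "smult (tpow k A S) = smult (tpow_module k A S)"
  by (simp_all add: tpow_def)

lemma pure_cong: "(\<And>s. s \<in> S \<Longrightarrow> a s = b s) \<Longrightarrow> pure k A S a = pure k A S b"
  unfolding pure_def by (metis restrict_ext)

lemma upd_in_PiE: "a \<in> S \<rightarrow>\<^sub>E B \<Longrightarrow> s \<in> S \<Longrightarrow> u \<in> B \<Longrightarrow> a(s := u) \<in> S \<rightarrow>\<^sub>E B"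
  by (auto simp: PiE_iff extensional_def)

locale tensor_powers = algebra k A
  for k :: "('k, 'w) ring_scheme" and A :: "('k, 'a, 'z) module_scheme"
begin

lemma tpow_presentation: "presentation k (S \<rightarrow>\<^sub>E carrier A) (tpow_rels k A S)"
proof
  interpret F: module k "free_module k (S \<rightarrow>\<^sub>E carrier A)"
    by (rule R.free_module_is_module)
  show "tpow_rels k A S \<subseteq> carrier (free_module k (S \<rightarrow>\<^sub>E carrier A))"
    unfolding tpow_rels_def Let_def
    by (auto simp: R.basis_in_free_module upd_in_PiE simp del: free_module_simps fun_upd_apply
        intro!: F.M.minus_closed)
qed

text \<open>\<open>tpow\<close> overwrites only \<open>mult\<close> and \<open>one\<close> of
  \<open>tpow_module\<close>, and these enter neither the additive group nor the scalar
  action.\<close>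

lemma tpow_is_module: "module k (tpow k A S)"
proof -
  interpret T: module k "tpow_module k A S"
    using presentation.presented_is_module[OF tpow_presentation] by (simp add: tpow_module_def)
  have "abelian_group (tpow k A S)"
    using T.M.abelian_group_axioms
    by (simp add: abelian_group_def abelian_group_axioms_def abelian_monoid_def tpow_def)
  then show ?thesis
    by (intro moduleI)
      (auto simp: R.is_cring T.smult_l_distr T.smult_r_distr T.smult_assoc1)
qed

lemma module_hom_tpow: "module_hom k (tpow k A S) W = module_hom k (tpow_module k A S) W"
  by (simp add: module_hom_def)

lemma multilinear_respects_rels:
  assumes "module k W" "multilinear k A S W \<phi>"
  shows "respects_rels k W (S \<rightarrow>\<^sub>E carrier A) (tpow_rels k A S) \<phi>"
proof -
  interpret W: module k W by fact
  interpret F: module k "free_module k (S \<rightarrow>\<^sub>E carrier A)"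
    by (rule R.free_module_is_module)
  let ?F = "free_module k (S \<rightarrow>\<^sub>E carrier A)" and ?e = "linear_extension k W \<phi>"
  have \<phi>: "\<phi> \<in> (S \<rightarrow>\<^sub>E carrier A) \<rightarrow> carrier W"
    using assms(2) by (simp add: multilinear_def)
  have upd: "(\<lambda>u. \<phi> (a(s := u))) \<in> module_hom k A W" if "a \<in> S \<rightarrow>\<^sub>E carrier A" "s \<in> S" for a s
    using assms(2) that by (simp add: multilinear_def)
  have hom: "?e \<in> module_hom k ?F W"
    by (rule W.linear_extension_hom[OF \<phi>])
  note [simp] = W.linear_extension_basis[OF \<phi>] R.basis_in_free_module upd_in_PiE
    module_hom_minus[OF F.module_axioms assms(1) hom] module_hom_add[OF hom] module_hom_smult[OF hom]
    module_hom_closed[OF upd]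
  have "?e r = \<zero>\<^bsub>W\<^esub>" if "r \<in> tpow_rels k A S" for r
    using that unfolding tpow_rels_def Let_def
    by (elim UnE CollectE exE conjE)
      (simp_all add: module_hom_add[OF upd] module_hom_smult[OF upd] W.M.r_neg a_minus_def[of W]
        del: free_module_simps fun_upd_apply)
  with \<phi> show ?thesis by (simp add: respects_rels_def)
qed

lemma lift_tpow_hom:
  assumes "module k W" "multilinear k A S W \<phi>"
  shows "lift k W \<phi> \<in> module_hom k (tpow k A S) W"
  using presentation.lift_hom[OF tpow_presentation assms(1) multilinear_respects_rels[OF assms]]
  by (simp add: module_hom_tpow tpow_module_def)

text \<open>Generators are extensional functions, so \<open>pure\<close> restricts its argument and
  \<open>\<phi>\<close> is evaluated at the restriction. For products over fibres,
  \<open>fibre_prod_restrict\<close> removes it again.\<close>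

lemma lift_pure:
  assumes "module k W" "multilinear k A S W \<phi>" "a \<in> S \<rightarrow> carrier A"
  shows "lift k W \<phi> (pure k A S a) = \<phi> (restrict a S)"
  unfolding pure_def
  by (rule presentation.lift_generator[OF tpow_presentation assms(1) multilinear_respects_rels[OF assms(1,2)]])
    (use assms(3) in auto)

lemma lift_tpow_parametric_hom:
  assumes "module k V" "module k W"
    and "\<And>v. v \<in> carrier V \<Longrightarrow> multilinear k A S W (\<Phi> v)"
    and "\<And>a. a \<in> S \<rightarrow>\<^sub>E carrier A \<Longrightarrow> (\<lambda>v. \<Phi> v a) \<in> module_hom k V W"
    and "t \<in> carrier (tpow k A S)"
  shows "(\<lambda>v. lift k W (\<Phi> v) t) \<in> module_hom k V W"
  by (rule presentation.lift_parametric_hom[OF tpow_presentation assms(1,2)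
        multilinear_respects_rels[OF assms(2,3)] assms(4)])
    (use assms(5) in \<open>auto simp: tpow_module_def\<close>)

lemma tpow_hom_eqI:
  assumes "module k W" "f \<in> module_hom k (tpow k A S) W" "g \<in> module_hom k (tpow k A S) W"
    and "\<And>a. a \<in> S \<rightarrow>\<^sub>E carrier A \<Longrightarrow> f (pure k A S a) = g (pure k A S a)"
    and "t \<in> carrier (tpow k A S)"
  shows "f t = g t"
proof (rule presentation.presented_hom_eqI[OF tpow_presentation assms(1)])
  fix a assume a: "a \<in> S \<rightarrow>\<^sub>E carrier A"
  then have "restrict a S = a" by (auto simp: restrict_PiE_iff intro: PiE_restrict)
  then show "f (generator k (S \<rightarrow>\<^sub>E carrier A) (tpow_rels k A S) a)
      = g (generator k (S \<rightarrow>\<^sub>E carrier A) (tpow_rels k A S) a)"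
    using assms(4)[OF a] by (simp add: pure_def)
qed (use assms(2,3,5) in \<open>auto simp: module_hom_tpow tpow_module_def\<close>)

lemma pure_closed:
  assumes "a \<in> S \<rightarrow> carrier A"
  shows "pure k A S a \<in> carrier (tpow k A S)"
  unfolding pure_def tpow_simps tpow_module_def
  by (rule presentation.generator_closed[OF tpow_presentation]) (use assms in auto)

text \<open>The relations in \<open>tpow_rels\<close> are imposed for exactly this. Later
  multilinearity proofs compose it with multiplication by a fixed element of \<open>A\<close> in the
  varying slot.\<close>

lemma pure_upd_hom:
  assumes "a \<in> S \<rightarrow> carrier A" "s \<in> S"
  shows "(\<lambda>u. pure k A S (a(s := u))) \<in> module_hom k A (tpow k A S)"
proof -
  interpret P: presentation k "S \<rightarrow>\<^sub>E carrier A" "tpow_rels k A S"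
    by (rule tpow_presentation)
  interpret T: module k "tpow k A S" by (rule tpow_is_module)
  let ?F = "free_module k (S \<rightarrow>\<^sub>E carrier A)"
  let ?q = "\<lambda>f. P.N +>\<^bsub>?F\<^esub> f" and ?a = "restrict a S"
  have a: "?a \<in> S \<rightarrow>\<^sub>E carrier A" using assms by auto
  have hom: "?q \<in> module_hom k ?F (tpow k A S)"
    using P.coset_hom by (simp add: module_hom_def tpow_module_def)
  have pure: "pure k A S (a(s := u)) = ?q (basis k (?a(s := u)))" for u
  proof -
    have "restrict (a(s := u)) S = ?a(s := u)" using assms(2) by auto
    then show ?thesis by (simp add: pure_def generator_def)
  qed
  have b [simp]: "basis k (?a(s := u)) \<in> carrier ?F" if "u \<in> carrier A" for u
    using that a assms(2) by (simp add: R.basis_in_free_module upd_in_PiE del: fun_upd_apply)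
  have *: "?q (basis k (?a(s := u \<oplus>\<^bsub>A\<^esub> v))) = ?q (basis k (?a(s := u)) \<oplus>\<^bsub>?F\<^esub> basis k (?a(s := v)))"
    if "u \<in> carrier A" "v \<in> carrier A" for u v
    by (insert that a assms(2), rule P.coset_eqI, unfold tpow_rels_def Let_def, blast)
      (simp_all del: free_module_simps fun_upd_apply)
  have **: "?q (basis k (?a(s := c \<odot>\<^bsub>A\<^esub> u))) = ?q (c \<odot>\<^bsub>?F\<^esub> basis k (?a(s := u)))"
    if "c \<in> carrier k" "u \<in> carrier A" for c u
    by (insert that a assms(2), rule P.coset_eqI, unfold tpow_rels_def Let_def, blast)
      (simp_all del: free_module_simps fun_upd_apply)
  show ?thesis
    unfolding pure
    by (rule module_homI)
      (simp_all add: * ** module_hom_closed[OF hom] module_hom_add[OF hom] module_hom_smult[OF hom]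
        del: free_module_simps fun_upd_apply tpow_simps)
qed

end


section \<open>Isomorphisms of homology\<close>

text \<open>All operations of \<open>quotient_module\<close> are formed elementwise from cosets, so
  taking direct images under a linear bijection transports them verbatim, for arbitrary subsets
  \<open>Z\<close> and \<open>U\<close>. Injectivity on cosets is injectivity of \<open>f\<close> on
  subsets of the carrier.\<close>

lemma quotient_isomorphic:
  assumes V: "module k V" and W: "module k W"
    and f: "f \<in> module_hom k V W" "bij_betw f (carrier V) (carrier W)"
    and U: "U \<subseteq> carrier V" and Z: "Z \<subseteq> carrier V"
  shows "isomorphic_modules k (quotient_module (V\<lparr>carrier := Z\<rparr>) U)
    (quotient_module (W\<lparr>carrier := f ` Z\<rparr>) (f ` U))"
proof -
  interpret V: module k V by fact
  interpret W: module k W by fact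
  let ?Q = "quotient_module (V\<lparr>carrier := Z\<rparr>) U" and ?Q' = "quotient_module (W\<lparr>carrier := f ` Z\<rparr>) (f ` U)"
  have car: "carrier ?Q = {U +>\<^bsub>V\<^esub> x | x. x \<in> Z}"
    "carrier ?Q' = {f ` U +>\<^bsub>W\<^esub> f x | x. x \<in> Z}"
    by (auto simp: quotient_module_def A_RCOSETS_def' a_r_coset_def')
  have sub: "U +>\<^bsub>V\<^esub> x \<subseteq> carrier V" if "x \<in> carrier V" for x
    using U that by (auto simp: a_r_coset_def')
  have coset: "f ` (U +>\<^bsub>V\<^esub> x) = f ` U +>\<^bsub>W\<^esub> f x" if "x \<in> carrier V" for x
    using U that module_hom_add[OF f(1)] by (fastforce simp: a_r_coset_def' image_iff subset_iff)
  have "(\<lambda>X. f ` X) \<in> module_hom k ?Q ?Q'"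
  proof (rule module_homI)
    fix X assume "X \<in> carrier ?Q"
    then show "f ` X \<in> carrier ?Q'" using coset Z by (auto simp: car)
  next
    fix X Y assume "X \<in> carrier ?Q" "Y \<in> carrier ?Q"
    then have "X \<subseteq> carrier V" "Y \<subseteq> carrier V" using sub Z by (auto simp: car)
    then show "f ` (X \<oplus>\<^bsub>?Q\<^esub> Y) = f ` X \<oplus>\<^bsub>?Q'\<^esub> f ` Y"
      using module_hom_add[OF f(1)]
      by (fastforce simp: quotient_module_def set_add_def' image_iff subset_iff)
  next
    fix c X assume c: "c \<in> carrier k" and "X \<in> carrier ?Q"
    then have X: "X \<subseteq> carrier V" using sub Z by (auto simp: car)
    have "f ` (c \<odot>\<^bsub>?Q\<^esub> X) = (\<Union>x\<in>X. f ` (U +>\<^bsub>V\<^esub> (c \<odot>\<^bsub>V\<^esub> x)))"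
      by (simp add: quotient_module_def a_r_coset_def' image_UN)
    also have "\<dots> = (\<Union>x\<in>X. f ` U +>\<^bsub>W\<^esub> (c \<odot>\<^bsub>W\<^esub> f x))"
    proof (rule SUP_cong[OF refl])
      fix x assume "x \<in> X"
      then have x: "x \<in> carrier V" using X by auto
      then show "f ` (U +>\<^bsub>V\<^esub> (c \<odot>\<^bsub>V\<^esub> x)) = f ` U +>\<^bsub>W\<^esub> (c \<odot>\<^bsub>W\<^esub> f x)"
        using c by (simp only: coset V.smult_closed module_hom_smult[OF f(1)])
    qed
    also have "\<dots> = c \<odot>\<^bsub>?Q'\<^esub> (f ` X)"
      by (simp add: quotient_module_def a_r_coset_def')
    finally show "f ` (c \<odot>\<^bsub>?Q\<^esub> X) = c \<odot>\<^bsub>?Q'\<^esub> (f ` X)" .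
  qed
  moreover have "bij_betw (\<lambda>X. f ` X) (carrier ?Q) (carrier ?Q')"
  proof (rule bij_betw_imageI)
    have inj: "inj_on f (carrier V)" using f(2) by (rule bij_betw_imp_inj_on)
    show "inj_on (\<lambda>X. f ` X) (carrier ?Q)"
    proof (rule inj_onI)
      fix X Y assume "X \<in> carrier ?Q" "Y \<in> carrier ?Q" "f ` X = f ` Y"
      moreover from this have "X \<subseteq> carrier V" "Y \<subseteq> carrier V" using sub Z by (auto simp: car)
      ultimately show "X = Y" using inj_on_image_eq_iff[OF inj] by blast
    qed
    show "(\<lambda>X. f ` X) ` carrier ?Q = carrier ?Q'"
      unfolding car setcompr_eq_image image_image using coset Z by (intro image_cong) auto
  qed
  ultimately show ?thesis
    unfolding isomorphic_modules_def by blast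
qed

text \<open>Commuting with all faces, the linear bijections commute with the differentials, hence
  match the cycles and the boundaries of the two complexes as sets;
  \<open>quotient_isomorphic\<close> does the rest.\<close>

lemma homology_isomorphic:
  assumes C: "\<And>n. module k (obj C n)" and D: "\<And>n. module k (obj D n)"
    and f: "\<And>n. f n \<in> module_hom k (obj C n) (obj D n)"
      "\<And>n. bij_betw (f n) (carrier (obj C n)) (carrier (obj D n))"
    and closed: "\<And>n i x. 1 \<le> n \<Longrightarrow> i \<le> n \<Longrightarrow> x \<in> carrier (obj C n) \<Longrightarrow>
      face C n i x \<in> carrier (obj C (n - 1))"
    and comm: "\<And>n i x. 1 \<le> n \<Longrightarrow> i \<le> n \<Longrightarrow> x \<in> carrier (obj C n) \<Longrightarrow>
      f (n - 1) (face C n i x) = face D n i (f n x)"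
  shows "isomorphic_modules k (homology k C n) (homology k D n)"
proof -
  interpret C: module k "obj C m" for m by (rule C)
  interpret D: module k "obj D m" for m by (rule D)
  note fcl = module_hom_closed[OF f(1)]
  have sgn: "(\<ominus>\<^bsub>k\<^esub> \<one>\<^bsub>k\<^esub>) [^]\<^bsub>k\<^esub> i \<in> carrier k" for i :: nat
    by simp
  have term_closed: "(\<lambda>i. ((\<ominus>\<^bsub>k\<^esub> \<one>\<^bsub>k\<^esub>) [^]\<^bsub>k\<^esub> i) \<odot>\<^bsub>obj C (m - 1)\<^esub> face C m i x)
      \<in> {0..m} \<rightarrow> carrier (obj C (m - 1))" if "1 \<le> m" "x \<in> carrier (obj C m)" for m x
    using closed that sgn by (auto intro!: C.smult_closed)
  have d_closed: "differential k C m x \<in> carrier (obj C (m - 1))"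
    if "1 \<le> m" "x \<in> carrier (obj C m)" for m x
    unfolding differential_def by (rule C.M.finsum_closed[OF term_closed[OF that]])
  have d_comm: "f (m - 1) (differential k C m x) = differential k D m (f m x)"
    if m: "1 \<le> m" and x: "x \<in> carrier (obj C m)" for m x
  proof -
    have "f (m - 1) (differential k C m x)
        = (\<Oplus>\<^bsub>obj D (m - 1)\<^esub>i\<in>{0..m}. f (m - 1) (((\<ominus>\<^bsub>k\<^esub> \<one>\<^bsub>k\<^esub>) [^]\<^bsub>k\<^esub> i) \<odot>\<^bsub>obj C (m - 1)\<^esub> face C m i x))"
      unfolding differential_def
      by (rule module_hom_finsum[OF C D f(1) _ term_closed[OF m x]]) simp
    also have "\<dots> = differential k D m (f m x)"
      unfolding differential_def
    proof (rule D.M.finsum_cong'[OF refl])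
      fix i assume i: "i \<in> {0..m}"
      show "f (m - 1) (((\<ominus>\<^bsub>k\<^esub> \<one>\<^bsub>k\<^esub>) [^]\<^bsub>k\<^esub> i) \<odot>\<^bsub>obj C (m - 1)\<^esub> face C m i x)
          = ((\<ominus>\<^bsub>k\<^esub> \<one>\<^bsub>k\<^esub>) [^]\<^bsub>k\<^esub> i) \<odot>\<^bsub>obj D (m - 1)\<^esub> face D m i (f m x)"
        using i m x by (simp only: module_hom_smult[OF f(1) sgn closed] comm atLeastAtMost_iff)
    next
      \<comment> \<open>\<open>comm\<close> rewrites each face of \<open>D\<close> at
        \<open>f m x\<close> as a value of \<open>f (m - 1)\<close>, which puts it in the
        carrier.\<close>
      show "(\<lambda>i. ((\<ominus>\<^bsub>k\<^esub> \<one>\<^bsub>k\<^esub>) [^]\<^bsub>k\<^esub> i) \<odot>\<^bsub>obj D (m - 1)\<^esub> face D m i (f m x))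
          \<in> {0..m} \<rightarrow> carrier (obj D (m - 1))"
        using comm[OF m _ x, symmetric] fcl[OF closed[OF m _ x]] sgn
        by (auto intro!: D.smult_closed)
    qed
    finally show ?thesis .
  qed
  have inj: "inj_on (f m) (carrier (obj C m))" and surj: "f m ` carrier (obj C m) = carrier (obj D m)" for m
    using f(2)[of m] by (auto simp: bij_betw_def)
  have zero: "f m \<zero>\<^bsub>obj C m\<^esub> = \<zero>\<^bsub>obj D m\<^esub>" for m
    by (rule module_hom_zero[OF C D f(1)])
  have cycles: "cycles k D n = f n ` cycles k C n"
  proof (cases "n = 0")
    case True
    then show ?thesis by (simp add: cycles_def surj)
  next
    case False
    then have n: "1 \<le> n" by simp
    \<comment> \<open>Injectivity in degree \<open>n - 1\<close> reflects the vanishing of the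
      differential back to \<open>C\<close>.\<close>
    have "differential k D n (f n x) = \<zero>\<^bsub>obj D (n - 1)\<^esub> \<longleftrightarrow> differential k C n x = \<zero>\<^bsub>obj C (n - 1)\<^esub>"
      if "x \<in> carrier (obj C n)" for x
      using inj_on_eq_iff[OF inj d_closed[OF n that] C.M.zero_closed] d_comm[OF n that] zero by metis
    then show ?thesis
      using False unfolding cycles_def surj[symmetric] by auto
  qed
  have boundaries: "boundaries k D n = f n ` boundaries k C n"
    using d_comm[of "n + 1"] unfolding boundaries_def surj[symmetric]
    by (auto simp: image_image)
  have "boundaries k C n \<subseteq> carrier (obj C n)" "cycles k C n \<subseteq> carrier (obj C n)"
    using d_closed[of "n + 1"] by (auto simp: boundaries_def cycles_def)
  from quotient_isomorphic[OF C D f(1) f(2) this] show ?thesis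
    by (simp only: homology_def cycles boundaries)
qed


section \<open>Fibre products\<close>

context tensor_powers
begin

lemma fibre_prod_closed: "a \<in> S \<rightarrow> carrier A \<Longrightarrow> fibre_prod A S f a t \<in> carrier A"
  unfolding fibre_prod_def by (rule finprod_closed) auto

lemma fibre_prod_cong:
  assumes "a \<in> S \<rightarrow> carrier A" "\<And>s. s \<in> S \<Longrightarrow> f s = t \<Longrightarrow> b s = a s"
  shows "fibre_prod A S f b t = fibre_prod A S f a t"
  unfolding fibre_prod_def by (rule finprod_cong'[OF refl]) (use assms in blast)+

lemma fibre_prod_restrict:
  assumes "a \<in> S \<rightarrow> carrier A"
  shows "fibre_prod A S f (restrict a S) = fibre_prod A S f a"
  using assms by (intro ext fibre_prod_cong) auto

lemma fibre_prod_empty: "(\<And>s. s \<in> S \<Longrightarrow> f s \<noteq> t) \<Longrightarrow> fibre_prod A S f a t = \<one>\<^bsub>A\<^esub>"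
proof -
  assume "\<And>s. s \<in> S \<Longrightarrow> f s \<noteq> t"
  then have "{s \<in> S. f s = t} = {}" by auto
  then show ?thesis by (simp only: fibre_prod_def finprod_empty)
qed

lemma fibre_prod_singleton:
  assumes "a \<in> S \<rightarrow> carrier A" "s \<in> S" "f s = t" "\<And>s'. s' \<in> S \<Longrightarrow> f s' = t \<Longrightarrow> s' = s"
  shows "fibre_prod A S f a t = a s"
proof -
  have "{s' \<in> S. f s' = t} = {s}" using assms(2-4) by blast
  moreover have "a s \<in> carrier A" using assms(1,2) by blast
  ultimately show ?thesis by (simp add: fibre_prod_def)
qed

text \<open>The slot \<open>s\<close> contributes to a single fibre, the one over
  \<open>f s\<close>, and there as one factor; \<open>c\<close> is the product of the remaining
  factors and does not depend on \<open>u\<close>. Multilinearity of fibre products thus reduces to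
  multiplication by a constant.\<close>

lemma fibre_prod_upd:
  assumes "finite S" "a \<in> S \<rightarrow> carrier A" "s \<in> S"
  obtains c where "c \<in> carrier A"
    "\<And>u. u \<in> carrier A \<Longrightarrow> fibre_prod A S f (a(s := u)) = (fibre_prod A S f a)(f s := u \<otimes>\<^bsub>A\<^esub> c)"
proof
  let ?B = "{s' \<in> S. f s' = f s} - {s}"
  let ?c = "finprod A a ?B"
  have B: "finite ?B" "a \<in> ?B \<rightarrow> carrier A" using assms by auto
  then show "?c \<in> carrier A" by (intro finprod_closed)
  fix u assume u: "u \<in> carrier A"
  show "fibre_prod A S f (a(s := u)) = (fibre_prod A S f a)(f s := u \<otimes>\<^bsub>A\<^esub> ?c)"
  proof
    fix t
    show "fibre_prod A S f (a(s := u)) t = ((fibre_prod A S f a)(f s := u \<otimes>\<^bsub>A\<^esub> ?c)) t"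
    proof (cases "t = f s")
      case True
      have "{s' \<in> S. f s' = f s} = insert s ?B" using assms(3) by auto
      then have "fibre_prod A S f (a(s := u)) (f s) = finprod A (a(s := u)) (insert s ?B)"
        by (simp only: fibre_prod_def)
      also have "\<dots> = u \<otimes>\<^bsub>A\<^esub> finprod A (a(s := u)) ?B"
        using B u by (subst finprod_insert) auto
      also have "finprod A (a(s := u)) ?B = ?c"
        by (rule finprod_cong'[OF refl]) (use B in auto)
      finally show ?thesis using True by (simp del: fun_upd_apply add: fun_upd_same)
    next
      case False
      then have "fibre_prod A S f (a(s := u)) t = fibre_prod A S f a t"
        by (intro fibre_prod_cong) (use assms(2) in auto)
      then show ?thesis using False by simp
    qed
  qed
qed

text \<open>The fibre of the composite over \<open>t\<close> is the disjoint union of the fibres of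
  \<open>f\<close> over the points of the fibre of \<open>g\<close>, and commutativity of
  \<open>A\<close> lets the product be regrouped accordingly.\<close>

lemma fibre_prod_comp:
  assumes "finite S" "finite T" "f \<in> S \<rightarrow> T" "a \<in> S \<rightarrow> carrier A"
  shows "fibre_prod A T g (fibre_prod A S f a) t = fibre_prod A S (\<lambda>s. g (f s)) a t"
proof -
  have "{s \<in> S. g (f s) = t} = (\<Union>y\<in>{y \<in> T. g y = t}. {s \<in> S. f s = y})"
    using assms(3) by auto
  then have "fibre_prod A S (\<lambda>s. g (f s)) a t = finprod A a (\<Union>y\<in>{y \<in> T. g y = t}. {s \<in> S. f s = y})"
    by (simp only: fibre_prod_def)
  also have "\<dots> = finprod A (\<lambda>y. finprod A a {s \<in> S. f s = y}) {y \<in> T. g y = t}"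
    by (rule finprod_UN_disjoint) (use assms in \<open>auto simp: disjnt_def pairwise_def\<close>)
  finally show ?thesis by (simp add: fibre_prod_def[abs_def])
qed

lemma mult_right_hom:
  assumes "c \<in> carrier A"
  shows "(\<lambda>u. u \<otimes>\<^bsub>A\<^esub> c) \<in> module_hom k A A"
  by (rule module_homI) (use assms in \<open>auto simp: l_distr smult_assoc2\<close>)

lemma mult_left_hom:
  assumes "c \<in> carrier A"
  shows "(\<lambda>u. c \<otimes>\<^bsub>A\<^esub> u) \<in> module_hom k A A"
  using mult_right_hom[OF assms]
    module_hom_cong[of A "\<lambda>u. u \<otimes>\<^bsub>A\<^esub> c" "\<lambda>u. c \<otimes>\<^bsub>A\<^esub> u" k A] assms module
  by (simp add: m_comm)

lemma tpow_map_multilinear: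
  assumes "finite S" "f \<in> S \<rightarrow> T"
  shows "multilinear k A S (tpow k A T) (\<lambda>a. pure k A T (fibre_prod A S f a))"
  unfolding multilinear_def
proof (intro conjI ballI)
  show "(\<lambda>a. pure k A T (fibre_prod A S f a)) \<in> (S \<rightarrow>\<^sub>E carrier A) \<rightarrow> carrier (tpow k A T)"
    using fibre_prod_closed by (intro funcsetI pure_closed) (auto simp: PiE_def)
next
  fix a s assume a: "a \<in> S \<rightarrow>\<^sub>E carrier A" and s: "s \<in> S"
  have aS: "a \<in> S \<rightarrow> carrier A" using a by auto
  obtain c where c: "c \<in> carrier A"
    "\<And>u. u \<in> carrier A \<Longrightarrow> fibre_prod A S f (a(s := u)) = (fibre_prod A S f a)(f s := u \<otimes>\<^bsub>A\<^esub> c)"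
    using fibre_prod_upd[OF assms(1) aS s] by metis
  have "(\<lambda>u. pure k A T ((fibre_prod A S f a)(f s := u \<otimes>\<^bsub>A\<^esub> c))) \<in> module_hom k A (tpow k A T)"
    by (rule module_hom_compose[OF mult_right_hom[OF c(1)] pure_upd_hom])
      (use assms(2) s aS fibre_prod_closed in auto)
  then show "(\<lambda>u. pure k A T (fibre_prod A S f (a(s := u)))) \<in> module_hom k A (tpow k A T)"
    by (subst module_hom_cong[OF _ module]) (simp_all only: c(2))
qed

lemma tpow_map_hom:
  assumes "finite S" "f \<in> S \<rightarrow> T"
  shows "tpow_map k A S T f \<in> module_hom k (tpow k A S) (tpow k A T)"
  unfolding tpow_map_def by (rule lift_tpow_hom[OF tpow_is_module tpow_map_multilinear[OF assms]])

lemma tpow_map_pure: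
  assumes "finite S" "f \<in> S \<rightarrow> T" "a \<in> S \<rightarrow> carrier A"
  shows "tpow_map k A S T f (pure k A S a) = pure k A T (fibre_prod A S f a)"
  unfolding tpow_map_def
  by (simp add: lift_pure[OF tpow_is_module tpow_map_multilinear[OF assms(1,2)] assms(3)]
      fibre_prod_restrict[OF assms(3)])

text \<open>Uniqueness is used twice: for the tensor product, and then, with \<open>x\<close> fixed,
  for the tensor power in the second factor.\<close>

lemma tensor_pure_hom_eqI:
  assumes "tensor_product k R X ra (tpow k A S) la" "module k W"
    and "f \<in> module_hom k (tensor k R X ra (tpow k A S) la) W"
    and "g \<in> module_hom k (tensor k R X ra (tpow k A S) la) W"
    and "\<And>x a. x \<in> carrier X \<Longrightarrow> a \<in> S \<rightarrow> carrier A \<Longrightarrow>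
      f (tensor_elem k R X ra (tpow k A S) la x (pure k A S a))
      = g (tensor_elem k R X ra (tpow k A S) la x (pure k A S a))"
    and "t \<in> carrier (tensor k R X ra (tpow k A S) la)"
  shows "f t = g t"
proof -
  interpret T: tensor_product k R X ra "tpow k A S" la by fact
  have tens: "T.tens x \<in> module_hom k (tpow k A S) T.T" if "x \<in> carrier X" for x
    using T.tens_balanced that by (simp add: balanced_def)
  show ?thesis
  proof (rule T.tensor_hom_eqI[OF assms(2-4) _ assms(6)])
    fix x u assume x: "x \<in> carrier X" and u: "u \<in> carrier (tpow k A S)"
    show "f (T.tens x u) = g (T.tens x u)"
      by (rule tpow_hom_eqI[OF assms(2) module_hom_compose[OF tens[OF x] assms(3)]
            module_hom_compose[OF tens[OF x] assms(4)] _ u])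
        (use assms(5)[OF x] in auto)
  qed
qed

end


section \<open>The Loday construction\<close>

locale loday_coefficients = tensor_powers k A + Mod: module k M
  for k :: "('k, 'w) ring_scheme" and A :: "('k, 'a, 'z) module_scheme"
    and M :: "('k, 'm) module" and ra :: "'m \<Rightarrow> 'a \<Rightarrow> 'm" +
  assumes right_action: "right_action k A M ra"
begin

lemma ra_left_hom: "a \<in> carrier A \<Longrightarrow> (\<lambda>m. ra m a) \<in> module_hom k M M"
  and ra_right_hom: "m \<in> carrier M \<Longrightarrow> ra m \<in> module_hom k A M"
  and ra_one: "m \<in> carrier M \<Longrightarrow> ra m \<one>\<^bsub>A\<^esub> = m"
  and ra_mult: "a \<in> carrier A \<Longrightarrow> b \<in> carrier A \<Longrightarrow> m \<in> carrier M \<Longrightarrow>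
    ra m (a \<otimes>\<^bsub>A\<^esub> b) = ra (ra m a) b"
  using right_action by (auto simp: right_action_def)

lemma ra_closed: "m \<in> carrier M \<Longrightarrow> a \<in> carrier A \<Longrightarrow> ra m a \<in> carrier M"
  using module_hom_closed[OF ra_right_hom] .

lemma loday_tensor_product:
  "tensor_product k k M (\<lambda>m c. c \<odot>\<^bsub>M\<^esub> m) (tpow k A S) (\<lambda>c t. c \<odot>\<^bsub>tpow k A S\<^esub> t)"
proof -
  interpret T: module k "tpow k A S" by (rule tpow_is_module)
  show ?thesis by unfold_locales (use T.smult_closed in auto)
qed

lemma loday_is_module: "module k (loday k A M V v0)"
  unfolding loday_def by (rule tensor_product.tensor_is_module[OF loday_tensor_product])

lemma loday_elem_right_hom:
  "m \<in> carrier M \<Longrightarrow> loday_elem k A M V v0 m \<in> module_hom k (tpow k A (V - {v0})) (loday k A M V v0)"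
  and loday_elem_left_hom:
  "t \<in> carrier (tpow k A (V - {v0})) \<Longrightarrow>
    (\<lambda>m. loday_elem k A M V v0 m t) \<in> module_hom k M (loday k A M V v0)"
  using tensor_product.tens_balanced[OF loday_tensor_product, of "V - {v0}"]
  unfolding loday_def loday_elem_def balanced_def by blast+

lemma loday_hom_eqI:
  assumes "module k W" "f \<in> module_hom k (loday k A M V v0) W" "g \<in> module_hom k (loday k A M V v0) W"
    and "\<And>m a. m \<in> carrier M \<Longrightarrow> a \<in> V - {v0} \<rightarrow> carrier A \<Longrightarrow>
      f (loday_elem k A M V v0 m (pure k A (V - {v0}) a)) = g (loday_elem k A M V v0 m (pure k A (V - {v0}) a))"
    and "x \<in> carrier (loday k A M V v0)"
  shows "f x = g x"
  using tensor_pure_hom_eqI[OF loday_tensor_product assms(1), of f "V - {v0}" g x] assms(2-5)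
  unfolding loday_def loday_elem_def by blast

text \<open>Over the base ring the middle relation is a consequence of linearity, since the scalar
  comes out of either argument.\<close>

lemma balanced_over_base:
  assumes "module k W"
    and "\<And>t. t \<in> carrier (tpow k A S) \<Longrightarrow> (\<lambda>m. \<beta> m t) \<in> module_hom k M W"
    and "\<And>m. m \<in> carrier M \<Longrightarrow> \<beta> m \<in> module_hom k (tpow k A S) W"
  shows "balanced k k M (\<lambda>m c. c \<odot>\<^bsub>M\<^esub> m) (tpow k A S) (\<lambda>c t. c \<odot>\<^bsub>tpow k A S\<^esub> t) W \<beta>"
  unfolding balanced_def
proof (intro conjI ballI)
  fix m c t assume "m \<in> carrier M" "c \<in> carrier k" "t \<in> carrier (tpow k A S)"
  then show "\<beta> (c \<odot>\<^bsub>M\<^esub> m) t = \<beta> m (c \<odot>\<^bsub>tpow k A S\<^esub> t)"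
    by (simp only: module_hom_smult[OF assms(2)] module_hom_smult[OF assms(3)])
qed (use assms in auto)

text \<open>The Loday construction for \<open>S\<close> with a base point added, mapped to
  \<open>V\<close> with base point \<open>v0\<close>. With \<open>S\<close> equal to
  \<open>V - {v0}\<close> it is the map inside \<open>loday_map\<close>; with \<open>S\<close> equal
  to \<open>Z\<close> it induces \<open>to_loday\<close>.\<close>

definition collapse_map ::
    "'s set \<Rightarrow> 'v set \<Rightarrow> 'v \<Rightarrow> ('s \<Rightarrow> 'v) \<Rightarrow> 'm \<Rightarrow> (('s \<Rightarrow> 'a) \<Rightarrow> 'k) set
      \<Rightarrow> ('m \<times> (('v \<Rightarrow> 'a) \<Rightarrow> 'k) set \<Rightarrow> 'k) set"
  where "collapse_map S V v0 \<phi> m = lift k (loday k A M V v0)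
    (\<lambda>a. loday_elem k A M V v0 (ra m (fibre_prod A S \<phi> a v0)) (pure k A (V - {v0}) (fibre_prod A S \<phi> a)))"

lemma collapse_map_multilinear:
  assumes "finite S" "\<phi> \<in> S \<rightarrow> V" "m \<in> carrier M"
  shows "multilinear k A S (loday k A M V v0) (\<lambda>a.
    loday_elem k A M V v0 (ra m (fibre_prod A S \<phi> a v0)) (pure k A (V - {v0}) (fibre_prod A S \<phi> a)))"
  unfolding multilinear_def
proof (intro conjI ballI)
  have pure: "pure k A (V - {v0}) (fibre_prod A S \<phi> a) \<in> carrier (tpow k A (V - {v0}))"
    if "a \<in> S \<rightarrow> carrier A" for a
    by (rule pure_closed, rule funcsetI, rule fibre_prod_closed[OF that])
  have coef: "ra m (fibre_prod A S \<phi> a v0) \<in> carrier M" if "a \<in> S \<rightarrow> carrier A" for a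
    by (rule ra_closed[OF assms(3) fibre_prod_closed[OF that]])
  show "(\<lambda>a. loday_elem k A M V v0 (ra m (fibre_prod A S \<phi> a v0)) (pure k A (V - {v0}) (fibre_prod A S \<phi> a)))
      \<in> (S \<rightarrow>\<^sub>E carrier A) \<rightarrow> carrier (loday k A M V v0)"
    using coef pure by (intro funcsetI module_hom_closed[OF loday_elem_right_hom]) (auto simp: PiE_def)
  fix a s assume "a \<in> S \<rightarrow>\<^sub>E carrier A" and s: "s \<in> S"
  then have a: "a \<in> S \<rightarrow> carrier A" by auto
  obtain c where c: "c \<in> carrier A"
    "\<And>u. u \<in> carrier A \<Longrightarrow> fibre_prod A S \<phi> (a(s := u)) = (fibre_prod A S \<phi> a)(\<phi> s := u \<otimes>\<^bsub>A\<^esub> c)"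
    using fibre_prod_upd[OF assms(1) a s] by metis
  note eq = module_hom_cong[OF _ module, THEN iffD1, rotated]
  show "(\<lambda>u. loday_elem k A M V v0 (ra m (fibre_prod A S \<phi> (a(s := u)) v0))
        (pure k A (V - {v0}) (fibre_prod A S \<phi> (a(s := u))))) \<in> module_hom k A (loday k A M V v0)"
  \<comment> \<open>Over the base point the varying entry acts on the coefficient \<open>m\<close>;
    elsewhere it changes one entry of the pure tensor.\<close>
  proof (cases "\<phi> s = v0")
    case True
    have "(\<lambda>u. loday_elem k A M V v0 (ra m (u \<otimes>\<^bsub>A\<^esub> c)) (pure k A (V - {v0}) (fibre_prod A S \<phi> a)))
        \<in> module_hom k A (loday k A M V v0)"
      by (rule module_hom_compose[OF module_hom_compose[OF mult_right_hom[OF c(1)] ra_right_hom[OF assms(3)]]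
            loday_elem_left_hom[OF pure[OF a]]])
    then show ?thesis
    proof (rule eq)
      fix u assume "u \<in> carrier A"
      \<comment> \<open>The update takes place at \<open>v0\<close>, which is not an index of this
        pure tensor.\<close>
      moreover have "pure k A (V - {v0}) ((fibre_prod A S \<phi> a)(\<phi> s := u \<otimes>\<^bsub>A\<^esub> c))
          = pure k A (V - {v0}) (fibre_prod A S \<phi> a)"
        using True by (intro pure_cong) auto
      ultimately show "loday_elem k A M V v0 (ra m (u \<otimes>\<^bsub>A\<^esub> c)) (pure k A (V - {v0}) (fibre_prod A S \<phi> a))
          = loday_elem k A M V v0 (ra m (fibre_prod A S \<phi> (a(s := u)) v0))
              (pure k A (V - {v0}) (fibre_prod A S \<phi> (a(s := u))))"
        using True by (simp add: c(2) del: fun_upd_apply) simp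
    qed
  next
    case False
    have "(\<lambda>u. loday_elem k A M V v0 (ra m (fibre_prod A S \<phi> a v0))
          (pure k A (V - {v0}) ((fibre_prod A S \<phi> a)(\<phi> s := u \<otimes>\<^bsub>A\<^esub> c))))
        \<in> module_hom k A (loday k A M V v0)"
      by (rule module_hom_compose[OF module_hom_compose[OF mult_right_hom[OF c(1)]
              pure_upd_hom[OF funcsetI[OF fibre_prod_closed[OF a]]]] loday_elem_right_hom[OF coef[OF a]]])
        (use False s assms(2) in auto)
    then show ?thesis
    proof (rule eq)
      fix u assume "u \<in> carrier A"
      then show "loday_elem k A M V v0 (ra m (fibre_prod A S \<phi> a v0))
            (pure k A (V - {v0}) ((fibre_prod A S \<phi> a)(\<phi> s := u \<otimes>\<^bsub>A\<^esub> c)))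
          = loday_elem k A M V v0 (ra m (fibre_prod A S \<phi> (a(s := u)) v0))
              (pure k A (V - {v0}) (fibre_prod A S \<phi> (a(s := u))))"
        using False[symmetric] by (simp add: c(2))
    qed
  qed
qed

lemma collapse_map_right_hom:
  assumes "finite S" "\<phi> \<in> S \<rightarrow> V" "m \<in> carrier M"
  shows "collapse_map S V v0 \<phi> m \<in> module_hom k (tpow k A S) (loday k A M V v0)"
  unfolding collapse_map_def
  by (rule lift_tpow_hom[OF loday_is_module collapse_map_multilinear[OF assms]])

lemma collapse_map_pure:
  assumes "finite S" "\<phi> \<in> S \<rightarrow> V" "m \<in> carrier M" "a \<in> S \<rightarrow> carrier A"
  shows "collapse_map S V v0 \<phi> m (pure k A S a) =
    loday_elem k A M V v0 (ra m (fibre_prod A S \<phi> a v0)) (pure k A (V - {v0}) (fibre_prod A S \<phi> a))"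
  unfolding collapse_map_def
  by (simp add: lift_pure[OF loday_is_module collapse_map_multilinear[OF assms(1-3)] assms(4)]
      fibre_prod_restrict[OF assms(4)])

text \<open>Here \<open>m\<close> is a parameter inside a \<open>lift\<close>. On pure tensors,
  linearity comes from the right action on \<open>M\<close> and from the left argument of
  \<open>loday_elem\<close>.\<close>

lemma collapse_map_left_hom:
  assumes "finite S" "\<phi> \<in> S \<rightarrow> V" "t \<in> carrier (tpow k A S)"
  shows "(\<lambda>m. collapse_map S V v0 \<phi> m t) \<in> module_hom k M (loday k A M V v0)"
  unfolding collapse_map_def
proof (rule lift_tpow_parametric_hom[OF Mod.module_axioms loday_is_module
      collapse_map_multilinear[OF assms(1,2)] _ assms(3)])
  fix a assume "a \<in> S \<rightarrow>\<^sub>E carrier A"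
  then have a: "a \<in> S \<rightarrow> carrier A" by auto
  show "(\<lambda>m. loday_elem k A M V v0 (ra m (fibre_prod A S \<phi> a v0)) (pure k A (V - {v0}) (fibre_prod A S \<phi> a)))
      \<in> module_hom k M (loday k A M V v0)"
    by (rule module_hom_compose[OF ra_left_hom[OF fibre_prod_closed[OF a]]
          loday_elem_left_hom[OF pure_closed[OF funcsetI[OF fibre_prod_closed[OF a]]]]])
qed

lemma loday_map_eq:
  "loday_map k A M ra V v0 W w0 \<phi> =
    lift k (loday k A M W w0) (\<lambda>(m, t). collapse_map (V - {v0}) W w0 \<phi> m t)"
  unfolding loday_map_def collapse_map_def Let_def ..

lemma
  assumes "finite V" "\<phi> \<in> V \<rightarrow> W"
  shows loday_map_hom: "loday_map k A M ra V v0 W w0 \<phi> \<in> module_hom k (loday k A M V v0) (loday k A M W w0)"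
    and loday_map_elem: "m \<in> carrier M \<Longrightarrow> t \<in> carrier (tpow k A (V - {v0})) \<Longrightarrow>
      loday_map k A M ra V v0 W w0 \<phi> (loday_elem k A M V v0 m t) = collapse_map (V - {v0}) W w0 \<phi> m t"
proof -
  have bal: "balanced k k M (\<lambda>m c. c \<odot>\<^bsub>M\<^esub> m) (tpow k A (V - {v0})) (\<lambda>c t. c \<odot>\<^bsub>tpow k A (V - {v0})\<^esub> t)
      (loday k A M W w0) (collapse_map (V - {v0}) W w0 \<phi>)"
    by (rule balanced_over_base[OF loday_is_module collapse_map_left_hom collapse_map_right_hom])
      (use assms in auto)
  show "loday_map k A M ra V v0 W w0 \<phi> \<in> module_hom k (loday k A M V v0) (loday k A M W w0)"
    unfolding loday_map_eq loday_def[of k A M V v0]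
    by (rule tensor_product.lift_tensor_hom[OF loday_tensor_product loday_is_module bal])
  show "loday_map k A M ra V v0 W w0 \<phi> (loday_elem k A M V v0 m t) = collapse_map (V - {v0}) W w0 \<phi> m t"
    if "m \<in> carrier M" "t \<in> carrier (tpow k A (V - {v0}))"
    unfolding loday_map_eq loday_elem_def
    by (rule tensor_product.lift_tensor_elem[OF loday_tensor_product loday_is_module bal that])
qed

end


section \<open>The relative tensor product\<close>

context loday_coefficients
begin

text \<open>This and \<open>power_lact\<close> are the actions of \<open>M3\<close> and
  \<open>B3\<close> with arbitrary index sets \<open>Y\<close> and \<open>Z\<close> in place of
  \<open>y_plus n\<close> and \<open>z_plus n\<close>, which keeps the combinatorics of triples out
  of the algebra.\<close>

definition power_ract :: "'s set \<Rightarrow> 'm \<Rightarrow> (('s \<Rightarrow> 'a) \<Rightarrow> 'k) set \<Rightarrow> 'm"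
  where "power_ract Y m = lift k M (\<lambda>\<alpha>. ra m (\<Otimes>\<^bsub>A\<^esub>p \<in> Y. \<alpha> p))"

definition power_lact ::
    "'s set \<Rightarrow> 's set \<Rightarrow> (('s \<Rightarrow> 'a) \<Rightarrow> 'k) set \<Rightarrow> (('s \<Rightarrow> 'a) \<Rightarrow> 'k) set \<Rightarrow> (('s \<Rightarrow> 'a) \<Rightarrow> 'k) set"
  where "power_lact Y Z r t = lift k (tpow k A Z) (\<lambda>\<alpha>. lift k (tpow k A Z)
    (\<lambda>a. pure k A Z (\<lambda>p. if p \<in> Y then \<alpha> p \<otimes>\<^bsub>A\<^esub> a p else a p)) t) r"

abbreviation "power_tensor Y Z \<equiv>
  tensor k (tpow k A Y) M (power_ract Y) (tpow k A Z) (power_lact Y Z)"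

abbreviation "power_tensor_elem Y Z \<equiv>
  tensor_elem k (tpow k A Y) M (power_ract Y) (tpow k A Z) (power_lact Y Z)"

definition to_loday ::
    "'s set \<Rightarrow> 'v set \<Rightarrow> 'v \<Rightarrow> ('s \<Rightarrow> 'v) \<Rightarrow> ('m \<times> (('s \<Rightarrow> 'a) \<Rightarrow> 'k) set \<Rightarrow> 'k) set
      \<Rightarrow> ('m \<times> (('v \<Rightarrow> 'a) \<Rightarrow> 'k) set \<Rightarrow> 'k) set"
  where "to_loday Z V v0 \<phi> = lift k (loday k A M V v0) (\<lambda>(m, t). collapse_map Z V v0 \<phi> m t)"

text \<open>Viewed as the fibre over a point, the full product inherits
  \<open>fibre_prod_upd\<close> and \<open>fibre_prod_restrict\<close>.\<close>

lemma finprod_as_fibre_prod: "finprod A \<alpha> Y = fibre_prod A Y (\<lambda>p. ()) \<alpha> ()"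
  by (simp add: fibre_prod_def)

lemma power_ract_multilinear:
  assumes "finite Y" "m \<in> carrier M"
  shows "multilinear k A Y M (\<lambda>\<alpha>. ra m (finprod A \<alpha> Y))"
  unfolding multilinear_def
proof (intro conjI ballI)
  show "(\<lambda>\<alpha>. ra m (finprod A \<alpha> Y)) \<in> (Y \<rightarrow>\<^sub>E carrier A) \<rightarrow> carrier M"
    using assms(2) by (intro funcsetI ra_closed finprod_closed) auto
  fix \<alpha> s assume "\<alpha> \<in> Y \<rightarrow>\<^sub>E carrier A" and s: "s \<in> Y"
  then have \<alpha>: "\<alpha> \<in> Y \<rightarrow> carrier A" by auto
  obtain c where c: "c \<in> carrier A" "\<And>u. u \<in> carrier A \<Longrightarrow>
      fibre_prod A Y (\<lambda>p. ()) (\<alpha>(s := u)) = (fibre_prod A Y (\<lambda>p. ()) \<alpha>)(() := u \<otimes>\<^bsub>A\<^esub> c)"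
    using fibre_prod_upd[OF assms(1) \<alpha> s] by metis
  have "(\<lambda>u. ra m (u \<otimes>\<^bsub>A\<^esub> c)) \<in> module_hom k A M"
    by (rule module_hom_compose[OF mult_right_hom[OF c(1)] ra_right_hom[OF assms(2)]])
  then show "(\<lambda>u. ra m (finprod A (\<alpha>(s := u)) Y)) \<in> module_hom k A M"
    by (rule module_hom_cong[OF _ module, THEN iffD1, rotated])
      (simp add: finprod_as_fibre_prod c(2) del: fun_upd_apply add: fun_upd_same)
qed

lemma power_ract_right_hom:
  assumes "finite Y" "m \<in> carrier M"
  shows "power_ract Y m \<in> module_hom k (tpow k A Y) M"
  unfolding power_ract_def
  by (rule lift_tpow_hom[OF Mod.module_axioms power_ract_multilinear[OF assms]])

lemma power_ract_pure:
  assumes "finite Y" "m \<in> carrier M" "\<alpha> \<in> Y \<rightarrow> carrier A"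
  shows "power_ract Y m (pure k A Y \<alpha>) = ra m (finprod A \<alpha> Y)"
  using lift_pure[OF Mod.module_axioms power_ract_multilinear[OF assms(1,2)] assms(3)]
  unfolding power_ract_def finprod_as_fibre_prod fibre_prod_restrict[OF assms(3)] .

lemma power_lact_inner_multilinear:
  assumes "\<alpha> \<in> Y \<rightarrow> carrier A"
  shows "multilinear k A Z (tpow k A Z) (\<lambda>a. pure k A Z (\<lambda>p. if p \<in> Y then \<alpha> p \<otimes>\<^bsub>A\<^esub> a p else a p))"
  unfolding multilinear_def
proof (intro conjI ballI)
  have mix: "(\<lambda>p. if p \<in> Y then \<alpha> p \<otimes>\<^bsub>A\<^esub> a p else a p) \<in> Z \<rightarrow> carrier A" if "a \<in> Z \<rightarrow>\<^sub>E carrier A" for a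
    using assms that by (auto simp: Pi_iff PiE_iff)
  show "(\<lambda>a. pure k A Z (\<lambda>p. if p \<in> Y then \<alpha> p \<otimes>\<^bsub>A\<^esub> a p else a p))
      \<in> (Z \<rightarrow>\<^sub>E carrier A) \<rightarrow> carrier (tpow k A Z)"
    by (rule funcsetI, rule pure_closed, rule mix)
  fix a s assume a: "a \<in> Z \<rightarrow>\<^sub>E carrier A" and s: "s \<in> Z"
  have "(\<lambda>u. if s \<in> Y then \<alpha> s \<otimes>\<^bsub>A\<^esub> u else u) \<in> module_hom k A A"
    using assms mult_left_hom by (cases "s \<in> Y") (auto simp: module_hom_ident)
  from module_hom_compose[OF this pure_upd_hom[OF mix[OF a] s]]
  have "(\<lambda>u. pure k A Z ((\<lambda>p. if p \<in> Y then \<alpha> p \<otimes>\<^bsub>A\<^esub> a p else a p)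
      (s := if s \<in> Y then \<alpha> s \<otimes>\<^bsub>A\<^esub> u else u))) \<in> module_hom k A (tpow k A Z)" .
  then show "(\<lambda>u. pure k A Z (\<lambda>p. if p \<in> Y then \<alpha> p \<otimes>\<^bsub>A\<^esub> (a(s := u)) p else (a(s := u)) p))
      \<in> module_hom k A (tpow k A Z)"
    by (rule module_hom_cong[OF _ module, THEN iffD1, rotated]) (rule pure_cong, simp)
qed

text \<open>\<open>\<alpha>\<close> is a parameter of the inner \<open>lift\<close>, so linearity in
  one \<open>\<alpha> s\<close> is checked on pure tensors. There \<open>Y \<subseteq> Z\<close>
  ensures that \<open>s\<close> is a slot of the target, whose entry is the varying element times
  \<open>a s\<close>.\<close>

lemma power_lact_multilinear:
  assumes "Y \<subseteq> Z" "t \<in> carrier (tpow k A Z)"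
  shows "multilinear k A Y (tpow k A Z) (\<lambda>\<alpha>. lift k (tpow k A Z)
    (\<lambda>a. pure k A Z (\<lambda>p. if p \<in> Y then \<alpha> p \<otimes>\<^bsub>A\<^esub> a p else a p)) t)"
  unfolding multilinear_def
proof (intro conjI ballI)
  show "(\<lambda>\<alpha>. lift k (tpow k A Z) (\<lambda>a. pure k A Z (\<lambda>p. if p \<in> Y then \<alpha> p \<otimes>\<^bsub>A\<^esub> a p else a p)) t)
      \<in> (Y \<rightarrow>\<^sub>E carrier A) \<rightarrow> carrier (tpow k A Z)"
    by (rule funcsetI, rule module_hom_closed[OF lift_tpow_hom[OF tpow_is_module
            power_lact_inner_multilinear] assms(2)]) (simp add: PiE_def)
  fix \<alpha> s assume \<alpha>: "\<alpha> \<in> Y \<rightarrow>\<^sub>E carrier A" and s: "s \<in> Y"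
  show "(\<lambda>u. lift k (tpow k A Z)
      (\<lambda>a. pure k A Z (\<lambda>p. if p \<in> Y then (\<alpha>(s := u)) p \<otimes>\<^bsub>A\<^esub> a p else a p)) t) \<in> module_hom k A (tpow k A Z)"
  proof (rule lift_tpow_parametric_hom[OF module tpow_is_module power_lact_inner_multilinear _ assms(2)])
    fix u assume "u \<in> carrier A"
    then show "\<alpha>(s := u) \<in> Y \<rightarrow> carrier A" using \<alpha> by auto
  next
    fix a assume a: "a \<in> Z \<rightarrow>\<^sub>E carrier A"
    have mix: "(\<lambda>p. if p \<in> Y then \<alpha> p \<otimes>\<^bsub>A\<^esub> a p else a p) \<in> Z \<rightarrow> carrier A"
      using \<alpha> a by (auto simp: Pi_iff PiE_iff)
    have "a s \<in> carrier A" "s \<in> Z" using a s assms(1) by auto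
    from module_hom_compose[OF mult_right_hom[OF this(1)] pure_upd_hom[OF mix this(2)]]
    show "(\<lambda>u. pure k A Z (\<lambda>p. if p \<in> Y then (\<alpha>(s := u)) p \<otimes>\<^bsub>A\<^esub> a p else a p)) \<in> module_hom k A (tpow k A Z)"
      by (rule module_hom_cong[OF _ module, THEN iffD1, rotated]) (rule pure_cong, use s in simp)
  qed
qed

lemma power_lact_left_hom:
  assumes "Y \<subseteq> Z" "t \<in> carrier (tpow k A Z)"
  shows "(\<lambda>r. power_lact Y Z r t) \<in> module_hom k (tpow k A Y) (tpow k A Z)"
  unfolding power_lact_def
  by (rule lift_tpow_hom[OF tpow_is_module power_lact_multilinear[OF assms]])

lemma
  assumes "Y \<subseteq> Z" "\<alpha> \<in> Y \<rightarrow> carrier A"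
  shows power_lact_pure_hom: "power_lact Y Z (pure k A Y \<alpha>) \<in> module_hom k (tpow k A Z) (tpow k A Z)"
    and power_lact_pure: "a \<in> Z \<rightarrow> carrier A \<Longrightarrow> power_lact Y Z (pure k A Y \<alpha>) (pure k A Z a) =
      pure k A Z (\<lambda>p. if p \<in> Y then \<alpha> p \<otimes>\<^bsub>A\<^esub> a p else a p)"
proof -
  have \<alpha>: "restrict \<alpha> Y \<in> Y \<rightarrow> carrier A" using assms by auto
  \<comment> \<open>Evaluating the outer \<open>lift\<close> at a pure tensor produces
    \<open>restrict \<alpha> Y\<close>; it agrees with \<open>\<alpha>\<close> on \<open>Y\<close>,
    where alone the formula reads it.\<close>
  have lact: "power_lact Y Z (pure k A Y \<alpha>) t = lift k (tpow k A Z)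
      (\<lambda>a. pure k A Z (\<lambda>p. if p \<in> Y then restrict \<alpha> Y p \<otimes>\<^bsub>A\<^esub> a p else a p)) t"
    if "t \<in> carrier (tpow k A Z)" for t
    unfolding power_lact_def
    by (rule lift_pure[OF tpow_is_module power_lact_multilinear[OF assms(1) that] assms(2)])
  show "power_lact Y Z (pure k A Y \<alpha>) \<in> module_hom k (tpow k A Z) (tpow k A Z)"
    by (rule module_hom_cong[OF lact tpow_is_module, THEN iffD2])
      (simp_all only: lift_tpow_hom[OF tpow_is_module power_lact_inner_multilinear[OF \<alpha>]])
  show "power_lact Y Z (pure k A Y \<alpha>) (pure k A Z a) =
      pure k A Z (\<lambda>p. if p \<in> Y then \<alpha> p \<otimes>\<^bsub>A\<^esub> a p else a p)" if "a \<in> Z \<rightarrow> carrier A"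
    unfolding lact[OF pure_closed[OF that]]
      lift_pure[OF tpow_is_module power_lact_inner_multilinear[OF \<alpha>] that]
    by (rule pure_cong) auto
qed

lemma power_tensor_product:
  assumes "finite Y" "Y \<subseteq> Z"
  shows "tensor_product k (tpow k A Y) M (power_ract Y) (tpow k A Z) (power_lact Y Z)"
proof -
  interpret T: module k "tpow k A Z" by (rule tpow_is_module)
  show ?thesis
    by unfold_locales
      (use module_hom_closed[OF power_ract_right_hom[OF assms(1)]]
        module_hom_closed[OF power_lact_left_hom[OF assms(2)]] in blast)+
qed

text \<open>The entries of \<open>\<alpha>\<close> sit at indices that all go to \<open>v0\<close>:
  on pure tensors their product is collected there and acts on \<open>m\<close>, while the other
  fibres do not meet \<open>Y\<close>. Points outside \<open>Y\<close> may go to \<open>v0\<close>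
  as well, so the lemma also covers a collapse that follows a face map.\<close>

lemma collapse_map_balanced:
  assumes "finite Z" "Y \<subseteq> Z" "\<phi> \<in> Z \<rightarrow> V" "\<And>p. p \<in> Y \<Longrightarrow> \<phi> p = v0"
  shows "balanced k (tpow k A Y) M (power_ract Y) (tpow k A Z) (power_lact Y Z)
    (loday k A M V v0) (collapse_map Z V v0 \<phi>)"
proof -
  have Y: "finite Y" using assms(1,2) by (rule finite_subset[rotated])
  note right = collapse_map_right_hom[OF assms(1,3)] and left = collapse_map_left_hom[OF assms(1,3)]
  have "collapse_map Z V v0 \<phi> (power_ract Y m r) t = collapse_map Z V v0 \<phi> m (power_lact Y Z r t)"
    if m: "m \<in> carrier M" and r: "r \<in> carrier (tpow k A Y)" and t: "t \<in> carrier (tpow k A Z)" for m r t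
  proof (rule tpow_hom_eqI[OF loday_is_module
        module_hom_compose[OF power_ract_right_hom[OF Y m] left[OF t]]
        module_hom_compose[OF power_lact_left_hom[OF assms(2) t] right[OF m]] _ r])
    fix \<alpha> assume "\<alpha> \<in> Y \<rightarrow>\<^sub>E carrier A"
    then have \<alpha>: "\<alpha> \<in> Y \<rightarrow> carrier A" by auto
    let ?r = "finprod A \<alpha> Y"
    have r: "?r \<in> carrier A" by (rule finprod_closed[OF \<alpha>])
    have "collapse_map Z V v0 \<phi> (ra m ?r) t = collapse_map Z V v0 \<phi> m (power_lact Y Z (pure k A Y \<alpha>) t)"
    proof (rule tpow_hom_eqI[OF loday_is_module right[OF ra_closed[OF m r]]
          module_hom_compose[OF power_lact_pure_hom[OF assms(2) \<alpha>] right[OF m]] _ t])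
      fix a assume "a \<in> Z \<rightarrow>\<^sub>E carrier A"
      then have a: "a \<in> Z \<rightarrow> carrier A" by auto
      let ?b = "\<lambda>p. if p \<in> Y then \<alpha> p \<otimes>\<^bsub>A\<^esub> a p else a p" and ?B = "{p \<in> Z. \<phi> p = v0}"
      have b: "?b \<in> Z \<rightarrow> carrier A" using a \<alpha> by (auto simp: Pi_iff)
      \<comment> \<open>Extending \<open>\<alpha>\<close> by 1 outside \<open>Y\<close> gives all
        factors of the fibre the same form, so the product splits; the ones then drop out of the
        first factor.\<close>
      have "fibre_prod A Z \<phi> ?b v0 = finprod A (\<lambda>p. (if p \<in> Y then \<alpha> p else \<one>\<^bsub>A\<^esub>) \<otimes>\<^bsub>A\<^esub> a p) ?B"
        unfolding fibre_prod_def using a \<alpha> by (intro finprod_cong') (auto simp: Pi_iff)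
      also have "\<dots> = finprod A (\<lambda>p. if p \<in> Y then \<alpha> p else \<one>\<^bsub>A\<^esub>) ?B \<otimes>\<^bsub>A\<^esub> finprod A a ?B"
        using a \<alpha> by (intro finprod_multf) (auto simp: Pi_iff)
      also have "finprod A (\<lambda>p. if p \<in> Y then \<alpha> p else \<one>\<^bsub>A\<^esub>) ?B = ?r"
        using assms \<alpha> by (intro finprod_mono_neutral_cong_left[symmetric]) (auto simp: Pi_iff)
      finally have base: "fibre_prod A Z \<phi> ?b v0 = ?r \<otimes>\<^bsub>A\<^esub> fibre_prod A Z \<phi> a v0"
        by (simp add: fibre_prod_def)
      have rest: "pure k A (V - {v0}) (fibre_prod A Z \<phi> ?b) = pure k A (V - {v0}) (fibre_prod A Z \<phi> a)"
        using assms(4) by (intro pure_cong fibre_prod_cong[OF a]) auto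
      show "collapse_map Z V v0 \<phi> (ra m ?r) (pure k A Z a)
          = collapse_map Z V v0 \<phi> m (power_lact Y Z (pure k A Y \<alpha>) (pure k A Z a))"
        by (simp only: power_lact_pure[OF assms(2) \<alpha> a] collapse_map_pure[OF assms(1,3) m b]
            collapse_map_pure[OF assms(1,3) ra_closed[OF m r] a] base rest
            ra_mult[OF r fibre_prod_closed[OF a] m])
    qed
    then show "collapse_map Z V v0 \<phi> (power_ract Y m (pure k A Y \<alpha>)) t
        = collapse_map Z V v0 \<phi> m (power_lact Y Z (pure k A Y \<alpha>) t)"
      by (simp only: power_ract_pure[OF Y m \<alpha>])
  qed
  then show ?thesis
    unfolding balanced_def using left right by blast
qed

end

section \<open>The isomorphism in a fixed degree\<close>

locale collapse = loday_coefficients k A M ra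
  for k :: "('k, 'w) ring_scheme" and A :: "('k, 'a, 'z) module_scheme"
    and M :: "('k, 'm) module" and ra :: "'m \<Rightarrow> 'a \<Rightarrow> 'm" +
  fixes Z Y :: "'s set" and V :: "'v set" and v0 :: 'v and \<pi> :: "'s \<Rightarrow> 'v"
  assumes finite_Z: "finite Z" and finite_V: "finite V" and base_in: "v0 \<in> V"
    and Y_subset: "Y \<subseteq> Z" and \<pi>_in: "\<pi> \<in> Z \<rightarrow> V"
    and \<pi>_base_iff: "p \<in> Z \<Longrightarrow> \<pi> p = v0 \<longleftrightarrow> p \<in> Y"
    and \<pi>_bij: "bij_betw \<pi> (Z - Y) (V - {v0})"
begin

abbreviation "L \<equiv> power_tensor Y Z"
abbreviation "ltens \<equiv> power_tensor_elem Y Z"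
abbreviation "lod \<equiv> loday k A M V v0"

lemma finite_Y: "finite Y"
  using Y_subset finite_Z by (rule finite_subset)

lemma L_tensor_product: "tensor_product k (tpow k A Y) M (power_ract Y) (tpow k A Z) (power_lact Y Z)"
  by (rule power_tensor_product[OF finite_Y Y_subset])

lemma L_is_module: "module k L"
  by (rule tensor_product.tensor_is_module[OF L_tensor_product])

lemma ltens_left_hom: "t \<in> carrier (tpow k A Z) \<Longrightarrow> (\<lambda>m. ltens m t) \<in> module_hom k M L"
  and ltens_right_hom: "m \<in> carrier M \<Longrightarrow> ltens m \<in> module_hom k (tpow k A Z) L"
  and ltens_middle: "m \<in> carrier M \<Longrightarrow> r \<in> carrier (tpow k A Y) \<Longrightarrow> t \<in> carrier (tpow k A Z) \<Longrightarrow>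
    ltens (power_ract Y m r) t = ltens m (power_lact Y Z r t)"
  using tensor_product.tens_balanced[OF L_tensor_product] unfolding balanced_def by blast+

lemma collapse_balanced:
  "balanced k (tpow k A Y) M (power_ract Y) (tpow k A Z) (power_lact Y Z) lod (collapse_map Z V v0 \<pi>)"
  by (rule collapse_map_balanced[OF finite_Z Y_subset \<pi>_in]) (use Y_subset \<pi>_base_iff in auto)

lemma to_loday_hom: "to_loday Z V v0 \<pi> \<in> module_hom k L lod"
  unfolding to_loday_def
  by (rule tensor_product.lift_tensor_hom[OF L_tensor_product loday_is_module collapse_balanced])

lemma to_loday_elem:
  "m \<in> carrier M \<Longrightarrow> t \<in> carrier (tpow k A Z) \<Longrightarrow> to_loday Z V v0 \<pi> (ltens m t) = collapse_map Z V v0 \<pi> m t"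
  unfolding to_loday_def
  by (rule tensor_product.lift_tensor_elem[OF L_tensor_product loday_is_module collapse_balanced])

abbreviation "\<theta> \<equiv> inv_into (Z - Y) \<pi>"

lemma \<theta>_in: "\<theta> \<in> V - {v0} \<rightarrow> Z"
  using bij_betwE[OF bij_betw_inv_into[OF \<pi>_bij]] by auto

lemma \<pi>_\<theta>: "v \<in> V - {v0} \<Longrightarrow> \<pi> (\<theta> v) = v"
  by (rule bij_betw_inv_into_right[OF \<pi>_bij])

lemma \<theta>_\<pi>: "p \<in> Z - Y \<Longrightarrow> \<theta> (\<pi> p) = p"
  by (rule bij_betw_inv_into_left[OF \<pi>_bij])

lemma \<theta>_notin: "v \<in> V - {v0} \<Longrightarrow> \<theta> v \<in> Z - Y"
  using bij_betwE[OF bij_betw_inv_into[OF \<pi>_bij]] by auto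

text \<open>Units appear at the indices in \<open>Y\<close> without being mentioned:
  \<open>\<theta>\<close> sends no point of \<open>V - {v0}\<close> there, and the product over an
  empty fibre is 1.\<close>

definition from_loday where
  "from_loday = lift k L (\<lambda>(m, t). ltens m (tpow_map k A (V - {v0}) Z \<theta> t))"

lemma tpow_map_\<theta>_hom: "tpow_map k A (V - {v0}) Z \<theta> \<in> module_hom k (tpow k A (V - {v0})) (tpow k A Z)"
  using finite_V \<theta>_in by (intro tpow_map_hom) auto

lemma from_loday_balanced:
  "balanced k k M (\<lambda>m c. c \<odot>\<^bsub>M\<^esub> m) (tpow k A (V - {v0})) (\<lambda>c t. c \<odot>\<^bsub>tpow k A (V - {v0})\<^esub> t)
    L (\<lambda>m t. ltens m (tpow_map k A (V - {v0}) Z \<theta> t))"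
  by (rule balanced_over_base[OF L_is_module ltens_left_hom[OF module_hom_closed[OF tpow_map_\<theta>_hom]]
        module_hom_compose[OF tpow_map_\<theta>_hom ltens_right_hom]])

lemma from_loday_hom: "from_loday \<in> module_hom k lod L"
  unfolding from_loday_def loday_def
  by (rule tensor_product.lift_tensor_hom[OF loday_tensor_product L_is_module from_loday_balanced])

lemma from_loday_elem:
  "m \<in> carrier M \<Longrightarrow> t \<in> carrier (tpow k A (V - {v0})) \<Longrightarrow>
    from_loday (loday_elem k A M V v0 m t) = ltens m (tpow_map k A (V - {v0}) Z \<theta> t)"
  unfolding from_loday_def loday_elem_def
  by (rule tensor_product.lift_tensor_elem[OF loday_tensor_product L_is_module from_loday_balanced])

lemma to_loday_from_loday:
  assumes "x \<in> carrier lod"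
  shows "to_loday Z V v0 \<pi> (from_loday x) = x"
proof -
  have "(\<lambda>x. to_loday Z V v0 \<pi> (from_loday x)) x = (\<lambda>x. x) x"
  proof (rule loday_hom_eqI[OF loday_is_module
        module_hom_compose[OF from_loday_hom to_loday_hom] module_hom_ident _ assms])
    fix m a assume m: "m \<in> carrier M" and a: "a \<in> V - {v0} \<rightarrow> carrier A"
    let ?b = "fibre_prod A (V - {v0}) \<theta> a"
    have b: "?b \<in> Z \<rightarrow> carrier A" using fibre_prod_closed[OF a] by (rule funcsetI)
    have comp: "fibre_prod A Z \<pi> ?b v = fibre_prod A (V - {v0}) (\<lambda>v. \<pi> (\<theta> v)) a v" for v
      using finite_V finite_Z \<theta>_in a by (intro fibre_prod_comp) auto
    \<comment> \<open>No point of \<open>V - {v0}\<close> returns to \<open>v0\<close>, so nothing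
      acts on \<open>m\<close> and the coefficient is preserved.\<close>
    have "fibre_prod A Z \<pi> ?b v0 = \<one>\<^bsub>A\<^esub>"
      unfolding comp by (rule fibre_prod_empty) (use \<pi>_\<theta> in auto)
    moreover have "pure k A (V - {v0}) (fibre_prod A Z \<pi> ?b) = pure k A (V - {v0}) a"
    proof (rule pure_cong)
      fix v assume v: "v \<in> V - {v0}"
      show "fibre_prod A Z \<pi> ?b v = a v"
        unfolding comp by (rule fibre_prod_singleton[OF a v], rule \<pi>_\<theta>[OF v], metis \<pi>_\<theta>)
    qed
    moreover have "tpow_map k A (V - {v0}) Z \<theta> (pure k A (V - {v0}) a) = pure k A Z ?b"
      using finite_V \<theta>_in a by (intro tpow_map_pure) auto
    ultimately show "to_loday Z V v0 \<pi> (from_loday (loday_elem k A M V v0 m (pure k A (V - {v0}) a)))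
        = loday_elem k A M V v0 m (pure k A (V - {v0}) a)"
      by (simp only: from_loday_elem[OF m pure_closed[OF a]] to_loday_elem[OF m pure_closed[OF b]]
          collapse_map_pure[OF finite_Z \<pi>_in m b] ra_one[OF m])
  qed
  then show ?thesis .
qed

text \<open>The round trip replaces the entries of \<open>a\<close> on \<open>Y\<close> by units and
  multiplies \<open>m\<close> by their product. The relation over \<open>tpow k A Y\<close> undoes
  this: the product is the action on \<open>m\<close> of the pure tensor of those entries, which
  moves across the tensor sign and fills the units again.\<close>

lemma from_loday_to_loday:
  assumes "x \<in> carrier L"
  shows "from_loday (to_loday Z V v0 \<pi> x) = x"
proof -
  have "(\<lambda>x. from_loday (to_loday Z V v0 \<pi> x)) x = (\<lambda>x. x) x"
  proof (rule tensor_pure_hom_eqI[OF L_tensor_product L_is_module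
        module_hom_compose[OF to_loday_hom from_loday_hom] module_hom_ident _ assms])
    fix m a assume m: "m \<in> carrier M" and a: "a \<in> Z \<rightarrow> carrier A"
    let ?b = "fibre_prod A Z \<pi> a"
    let ?c = "fibre_prod A (V - {v0}) \<theta> ?b"
    have b: "?b \<in> V - {v0} \<rightarrow> carrier A" using fibre_prod_closed[OF a] by (rule funcsetI)
    have c: "?c \<in> Z \<rightarrow> carrier A" using fibre_prod_closed[OF b] by (rule funcsetI)
    have aY: "a \<in> Y \<rightarrow> carrier A" using a Y_subset by auto
    have "{p \<in> Z. \<pi> p = v0} = Y" using Y_subset \<pi>_base_iff by auto
    then have "?b v0 = finprod A a Y" by (simp only: fibre_prod_def)
    then have ract: "ra m (?b v0) = power_ract Y m (pure k A Y a)"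
      by (simp only: power_ract_pure[OF finite_Y m aY])
    have "pure k A Z (\<lambda>p. if p \<in> Y then a p \<otimes>\<^bsub>A\<^esub> ?c p else ?c p) = pure k A Z a"
    proof (rule pure_cong)
      fix p assume p: "p \<in> Z"
      then have ap: "a p \<in> carrier A" using a by auto
      show "(if p \<in> Y then a p \<otimes>\<^bsub>A\<^esub> ?c p else ?c p) = a p"
      proof (cases "p \<in> Y")
        case True
        have "?c p = \<one>\<^bsub>A\<^esub>"
          by (rule fibre_prod_empty) (use True \<theta>_notin in auto)
        then show ?thesis using True ap by simp
      next
        case False
        then have p: "p \<in> Z - Y" using p by auto
        then have \<pi>p: "\<pi> p \<in> V - {v0}" using \<pi>_in \<pi>_base_iff by auto
        have "?c p = ?b (\<pi> p)"
          by (rule fibre_prod_singleton[OF b \<pi>p], rule \<theta>_\<pi>[OF p], metis \<pi>_\<theta>)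
        also have "\<dots> = a p"
        \<comment> \<open>A second point over \<open>\<pi> p\<close> cannot lie in \<open>Y\<close>,
          because \<open>\<pi> p\<close> differs from \<open>v0\<close>; off \<open>Y\<close> the
          map is injective.\<close>
        proof (rule fibre_prod_singleton[OF a])
          fix p' assume p': "p' \<in> Z" "\<pi> p' = \<pi> p"
          then have "p' \<in> Z - Y" using \<pi>p \<pi>_base_iff[OF p'(1)] by auto
          then show "p' = p" using p'(2) p \<theta>_\<pi> by metis
        qed (use p in auto)
        finally show ?thesis using False by simp
      qed
    qed
    moreover have "tpow_map k A (V - {v0}) Z \<theta> (pure k A (V - {v0}) ?b) = pure k A Z ?c"
      using finite_V \<theta>_in b by (intro tpow_map_pure) auto
    moreover have "from_loday (to_loday Z V v0 \<pi> (ltens m (pure k A Z a)))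
        = ltens (ra m (?b v0)) (tpow_map k A (V - {v0}) Z \<theta> (pure k A (V - {v0}) ?b))"
      by (simp only: to_loday_elem[OF m pure_closed[OF a]] collapse_map_pure[OF finite_Z \<pi>_in m a]
          from_loday_elem[OF ra_closed[OF m fibre_prod_closed[OF a]] pure_closed[OF b]])
    ultimately show "from_loday (to_loday Z V v0 \<pi> (ltens m (pure k A Z a))) = ltens m (pure k A Z a)"
      by (simp only: ract ltens_middle[OF m pure_closed[OF aY] pure_closed[OF c]]
          power_lact_pure[OF Y_subset aY c])
  qed
  then show ?thesis .
qed

lemma to_loday_bij: "bij_betw (to_loday Z V v0 \<pi>) (carrier L) (carrier lod)"
  by (rule bij_betwI[where g = from_loday])
    (auto simp: from_loday_to_loday to_loday_from_loday
      module_hom_closed[OF to_loday_hom] module_hom_closed[OF from_loday_hom])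

end


section \<open>Compatibility with the face maps\<close>

context loday_coefficients
begin

context
  fixes Z Y :: "'s set" and V :: "'v set" and v0 \<pi>
    and Z' Y' :: "'t set" and V' :: "'u set" and v0' \<pi>' and s :: "'s \<Rightarrow> 't" and d :: "'v \<Rightarrow> 'u"
  assumes source: "collapse k A M ra Z Y V v0 \<pi>" and target: "collapse k A M ra Z' Y' V' v0' \<pi>'"
    and s_in: "s \<in> Z \<rightarrow> Z'" and d_in: "d \<in> V \<rightarrow> V'" and d_base: "d v0 = v0'"
    and square: "\<And>p. p \<in> Z \<Longrightarrow> \<pi>' (s p) = d (\<pi> p)"
begin

interpretation source: collapse k A M ra Z Y V v0 \<pi> by (rule source)
interpretation target: collapse k A M ra Z' Y' V' v0' \<pi>' by (rule target)

text \<open>By \<open>fibre_prod_comp\<close>, pushing along \<open>s\<close> and then collapsing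
  along \<open>\<pi>'\<close> is a single collapse along the composite. In this form
  \<open>collapse_map_balanced\<close> applies, which prepares the well-definedness of the face
  map.\<close>

lemma to_loday_tpow_map:
  assumes "m \<in> carrier M" "t \<in> carrier (tpow k A Z)"
  shows "to_loday Z' V' v0' \<pi>' (power_tensor_elem Y' Z' m (tpow_map k A Z Z' s t))
    = collapse_map Z V' v0' (\<lambda>p. \<pi>' (s p)) m t"
proof -
  have \<phi>: "(\<lambda>p. \<pi>' (s p)) \<in> Z \<rightarrow> V'" using s_in target.\<pi>_in by auto
  note map_hom = tpow_map_hom[OF source.finite_Z s_in]
  show ?thesis
  proof (rule tpow_hom_eqI[OF loday_is_module
        module_hom_compose[OF module_hom_compose[OF map_hom target.ltens_right_hom[OF assms(1)]] target.to_loday_hom]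
        collapse_map_right_hom[OF source.finite_Z \<phi> assms(1)] _ assms(2)])
    fix a assume "a \<in> Z \<rightarrow>\<^sub>E carrier A"
    then have a: "a \<in> Z \<rightarrow> carrier A" by auto
    let ?b = "fibre_prod A Z s a"
    have b: "?b \<in> Z' \<rightarrow> carrier A" using fibre_prod_closed[OF a] by (rule funcsetI)
    have comp: "fibre_prod A Z' \<pi>' ?b = fibre_prod A Z (\<lambda>p. \<pi>' (s p)) a"
      by (rule ext, rule fibre_prod_comp[OF source.finite_Z target.finite_Z s_in a])
    show "to_loday Z' V' v0' \<pi>' (power_tensor_elem Y' Z' m (tpow_map k A Z Z' s (pure k A Z a)))
        = collapse_map Z V' v0' (\<lambda>p. \<pi>' (s p)) m (pure k A Z a)"
      by (simp only: tpow_map_pure[OF source.finite_Z s_in a] target.to_loday_elem[OF assms(1) pure_closed[OF b]]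
          collapse_map_pure[OF target.finite_Z target.\<pi>_in assms(1) b]
          collapse_map_pure[OF source.finite_Z \<phi> assms(1) a] comp)
  qed
qed

text \<open>
  Since \<^term>\<open>to_loday\<close> is injective on the target, balancedness may be checked after applying it.
\<close>

lemma face_balanced:
  "balanced k (tpow k A Y) M (power_ract Y) (tpow k A Z) (power_lact Y Z) (power_tensor Y' Z')
    (\<lambda>m t. power_tensor_elem Y' Z' m (tpow_map k A Z Z' s t))"
proof -
  have \<phi>: "(\<lambda>p. \<pi>' (s p)) \<in> Z \<rightarrow> V'" using s_in target.\<pi>_in by auto
  have "\<pi>' (s p) = v0'" if "p \<in> Y" for p
    using that source.Y_subset source.\<pi>_base_iff square d_base by (metis subsetD)
  note bal = collapse_map_balanced[OF source.finite_Z source.Y_subset \<phi> this]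
  note map_hom = tpow_map_hom[OF source.finite_Z s_in]
  note left = target.ltens_left_hom[OF module_hom_closed[OF map_hom]]
  note right = module_hom_compose[OF map_hom target.ltens_right_hom]
  have inj: "inj_on (to_loday Z' V' v0' \<pi>') (carrier (power_tensor Y' Z'))"
    using target.to_loday_bij by (rule bij_betw_imp_inj_on)
  have "power_tensor_elem Y' Z' (power_ract Y m r) (tpow_map k A Z Z' s t)
      = power_tensor_elem Y' Z' m (tpow_map k A Z Z' s (power_lact Y Z r t))"
    if m: "m \<in> carrier M" and r: "r \<in> carrier (tpow k A Y)" and t: "t \<in> carrier (tpow k A Z)" for m r t
  proof (rule inj_onD[OF inj])
    have mr: "power_ract Y m r \<in> carrier M"
      by (rule module_hom_closed[OF power_ract_right_hom[OF source.finite_Y m] r])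
    have rt: "power_lact Y Z r t \<in> carrier (tpow k A Z)"
      by (rule module_hom_closed[OF power_lact_left_hom[OF source.Y_subset t] r])
    show "to_loday Z' V' v0' \<pi>' (power_tensor_elem Y' Z' (power_ract Y m r) (tpow_map k A Z Z' s t))
        = to_loday Z' V' v0' \<pi>' (power_tensor_elem Y' Z' m (tpow_map k A Z Z' s (power_lact Y Z r t)))"
      unfolding to_loday_tpow_map[OF mr t] to_loday_tpow_map[OF m rt]
      using bal m r t unfolding balanced_def by blast
    show "power_tensor_elem Y' Z' (power_ract Y m r) (tpow_map k A Z Z' s t) \<in> carrier (power_tensor Y' Z')"
      by (rule module_hom_closed[OF left[OF t] mr])
    show "power_tensor_elem Y' Z' m (tpow_map k A Z Z' s (power_lact Y Z r t)) \<in> carrier (power_tensor Y' Z')"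
      by (rule module_hom_closed[OF right[OF m] rt])
  qed
  then show ?thesis
    unfolding balanced_def using left right by blast
qed

abbreviation "power_face \<equiv> lift k (power_tensor Y' Z')
  (\<lambda>(m, t). power_tensor_elem Y' Z' m (tpow_map k A Z Z' s t))"

lemma power_face_hom: "power_face \<in> module_hom k (power_tensor Y Z) (power_tensor Y' Z')"
  by (rule tensor_product.lift_tensor_hom[OF source.L_tensor_product target.L_is_module face_balanced])

text \<open>On pure tensors both sides collapse along the diagonal of the square. The Loday map
  reaches the coefficient in two stages: first the entries that \<open>\<pi>\<close> sends to
  \<open>v0\<close>, then those at the remaining \<open>v\<close> with \<open>d v = v0'\<close>.
  Associativity of the action on \<open>M\<close> joins the two.\<close>

lemma to_loday_power_face:
  assumes "x \<in> carrier (power_tensor Y Z)"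
  shows "to_loday Z' V' v0' \<pi>' (power_face x) = loday_map k A M ra V v0 V' v0' d (to_loday Z V v0 \<pi> x)"
proof (rule tensor_pure_hom_eqI[OF source.L_tensor_product loday_is_module
      module_hom_compose[OF power_face_hom target.to_loday_hom]
      module_hom_compose[OF source.to_loday_hom loday_map_hom[OF source.finite_V d_in]] _ assms])
  fix m a assume m: "m \<in> carrier M" and a: "a \<in> Z \<rightarrow> carrier A"
  note pa = pure_closed[OF a]
  let ?b = "fibre_prod A Z \<pi> a" and ?V = "V - {v0}" and ?f = "fibre_prod A Z (\<lambda>p. \<pi>' (s p)) a"
  have \<phi>: "(\<lambda>p. \<pi>' (s p)) \<in> Z \<rightarrow> V'" using s_in target.\<pi>_in by auto
  have b: "?b \<in> S \<rightarrow> carrier A" for S using fibre_prod_closed[OF a] by (rule funcsetI)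
  have d': "d \<in> ?V \<rightarrow> V'" using d_in by auto
  have fV: "finite ?V" using source.finite_V by simp
  have comp: "?f w = fibre_prod A V d ?b w" for w
  proof -
    have "{p \<in> Z. \<pi>' (s p) = w} = {p \<in> Z. d (\<pi> p) = w}" using square by auto
    then have "?f w = fibre_prod A Z (\<lambda>p. d (\<pi> p)) a w" by (simp only: fibre_prod_def)
    then show ?thesis
      by (simp only: fibre_prod_comp[OF source.finite_Z source.finite_V source.\<pi>_in a])
  qed
  \<comment> \<open>Since \<open>d v0 = v0'\<close>, the base point lies in this fibre; splitting it
    off separates the factor already absorbed by \<open>to_loday\<close> from the one contributed by
    \<open>loday_map\<close>.\<close>
  have base: "?f v0' = ?b v0 \<otimes>\<^bsub>A\<^esub> fibre_prod A ?V d ?b v0'"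
  proof -
    have "{v \<in> V. d v = v0'} = insert v0 {v \<in> ?V. d v = v0'}"
      using source.base_in d_base by auto
    then have "?f v0' = finprod A ?b (insert v0 {v \<in> ?V. d v = v0'})"
      unfolding comp by (simp only: fibre_prod_def[of A V])
    also have "\<dots> = ?b v0 \<otimes>\<^bsub>A\<^esub> finprod A ?b {v \<in> ?V. d v = v0'}"
      using fV b fibre_prod_closed[OF a] by (intro finprod_insert) auto
    finally show ?thesis by (simp only: fibre_prod_def[of A ?V])
  qed
  have rest: "pure k A (V' - {v0'}) ?f = pure k A (V' - {v0'}) (fibre_prod A ?V d ?b)"
  proof (rule pure_cong)
    fix w assume "w \<in> V' - {v0'}"
    then have "{v \<in> V. d v = w} = {v \<in> ?V. d v = w}" using d_base by auto
    then show "?f w = fibre_prod A ?V d ?b w" unfolding comp by (simp only: fibre_prod_def)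
  qed
  note mb = ra_closed[OF m fibre_prod_closed[OF a]]
  have "to_loday Z' V' v0' \<pi>' (power_face (power_tensor_elem Y Z m (pure k A Z a)))
      = loday_elem k A M V' v0' (ra m (?f v0')) (pure k A (V' - {v0'}) ?f)"
    by (simp only: tensor_product.lift_tensor_elem[OF source.L_tensor_product target.L_is_module face_balanced m pa]
        to_loday_tpow_map[OF m pa] collapse_map_pure[OF source.finite_Z \<phi> m a])
  also have "\<dots> = loday_elem k A M V' v0' (ra (ra m (?b v0)) (fibre_prod A ?V d ?b v0'))
      (pure k A (V' - {v0'}) (fibre_prod A ?V d ?b))"
    by (simp only: base rest ra_mult[OF fibre_prod_closed[OF a] fibre_prod_closed[OF b] m])
  also have "\<dots> = loday_map k A M ra V v0 V' v0' d (to_loday Z V v0 \<pi> (power_tensor_elem Y Z m (pure k A Z a)))"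
    by (simp only: source.to_loday_elem[OF m pa] collapse_map_pure[OF source.finite_Z source.\<pi>_in m a]
        loday_map_elem[OF source.finite_V d_in mb pure_closed[OF b]] collapse_map_pure[OF fV d' mb b])
  finally show "to_loday Z' V' v0' \<pi>' (power_face (power_tensor_elem Y Z m (pure k A Z a)))
      = loday_map k A M ra V v0 V' v0' d (to_loday Z V v0 \<pi> (power_tensor_elem Y Z m (pure k A Z a)))" .
qed

end

end


section \<open>The simplicial model of the 3-sphere\<close>

text \<open>
  A triple \<open>j < k < l\<close> records the positions at which the vertices \<open>1\<close>, \<open>2\<close>, \<open>3\<close> first occur in a
  simplex \<open>Box a b c d\<close>; the triples in \<^term>\<open>y_plus n\<close> are those where some vertex is missing.
\<close>

definition simplex_of_triple :: "nat \<Rightarrow> nat \<times> nat \<times> nat \<Rightarrow> simplex3"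
  where "simplex_of_triple n = (\<lambda>(j, k, l).
    if (j, k, l) \<in> y_plus n then Base n else Box (j - 1) (k - j - 1) (l - k - 1) (n - l))"

text \<open>The vertex 0 fills positions 0 to \<open>a\<close>, so 1 starts at \<open>a + 1\<close>,
  2 at \<open>a + b + 2\<close> and 3 at \<open>a + b + c + 3\<close>. The value at
  \<open>Base n\<close> is a dummy; the function is an inverse off the base point.\<close>

definition triple_of_simplex :: "simplex3 \<Rightarrow> nat \<times> nat \<times> nat"
  where "triple_of_simplex \<sigma> = (case \<sigma> of
    Base n \<Rightarrow> (0, 0, 0) | Box a b c d \<Rightarrow> (a + 1, a + b + 2, a + b + c + 3))"

lemma finite_z_plus: "finite (z_plus n)"
  by (rule finite_subset[of _ "{..n + 1} \<times> {..n + 1} \<times> {..n + 1}"]) (auto simp: z_plus_def)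

lemma X3_simps [simp]:
  "base X3 n = Base n" "sface X3 n i = X3_face n i"
  "Base m \<in> simplices X3 n \<longleftrightarrow> m = n"
  "Box a b c d \<in> simplices X3 n \<longleftrightarrow> a + b + c + d + 3 = n"
  by (auto simp: X3_def)

lemma finite_simplices_X3: "finite (simplices X3 n)"
proof (rule finite_subset)
  show "simplices X3 n \<subseteq> insert (Base n)
      ((\<lambda>(a, b, c, d). Box a b c d) ` ({..n} \<times> {..n} \<times> {..n} \<times> {..n}))"
  proof
    fix \<sigma> assume \<sigma>: "\<sigma> \<in> simplices X3 n"
    show "\<sigma> \<in> insert (Base n) ((\<lambda>(a, b, c, d). Box a b c d) ` ({..n} \<times> {..n} \<times> {..n} \<times> {..n}))"
    proof (cases \<sigma>)
      case (Box a b c d)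
      then show ?thesis
        using \<sigma> by (intro insertI2 rev_image_eqI[of "(a, b, c, d)"]) auto
    qed (use \<sigma> in simp)
  qed
qed simp

lemma z_plus_minus_y_plus: "z_plus n - y_plus n = x_plus n"
  by (auto simp: z_plus_def y_plus_def x_plus_def)

lemma y_plus_subset: "y_plus n \<subseteq> z_plus n"
  by (auto simp: y_plus_def)

text \<open>Coordinates that avoid truncated subtraction: the triple and \<open>n\<close> become
  sums, with \<open>d = n - l\<close> counting the extra copies of the last vertex.\<close>

lemma x_plusE:
  assumes "p \<in> x_plus n"
  obtains a b c d where "p = (a + 1, a + b + 2, a + b + c + 3)" "n = a + b + c + d + 3"
proof -
  obtain j k l where p: "p = (j, k, l)" by (cases p)
  then have "1 \<le> j" "j < k" "k < l" "l \<le> n" using assms by (auto simp: x_plus_def)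
  then show thesis
    by (intro that[of "j - 1" "k - j - 1" "l - k - 1" "n - l"]) (simp_all add: p)
qed

lemma simplex_of_triple_Base: "p \<in> y_plus n \<Longrightarrow> simplex_of_triple n p = Base n"
  by (cases p) (simp add: simplex_of_triple_def)

lemma simplex_of_triple_Box:
  "n = a + b + c + d + 3 \<Longrightarrow> simplex_of_triple n (a + 1, a + b + 2, a + b + c + 3) = Box a b c d"
  by (simp add: simplex_of_triple_def y_plus_def)

lemma simplex_of_triple_bij:
  "bij_betw (simplex_of_triple n) (z_plus n - y_plus n) (simplices X3 n - {base X3 n})"
  unfolding z_plus_minus_y_plus
proof (rule bij_betwI)
  have Box: "\<exists>a b c d. \<sigma> = Box a b c d \<and> n = a + b + c + d + 3"
    if "\<sigma> \<in> simplices X3 n - {base X3 n}" for \<sigma>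
    using that by (cases \<sigma>) auto
  show "simplex_of_triple n \<in> x_plus n \<rightarrow> simplices X3 n - {base X3 n}"
    by (rule funcsetI, erule x_plusE) (simp only: simplex_of_triple_Box, simp)
  show "triple_of_simplex \<in> simplices X3 n - {base X3 n} \<rightarrow> x_plus n"
    by (rule funcsetI, drule Box) (elim exE conjE, simp add: triple_of_simplex_def x_plus_def)
  show "triple_of_simplex (simplex_of_triple n p) = p" if "p \<in> x_plus n" for p
    using that by (rule x_plusE) (simp only: simplex_of_triple_Box, simp add: triple_of_simplex_def)
  show "simplex_of_triple n (triple_of_simplex \<sigma>) = \<sigma>" if "\<sigma> \<in> simplices X3 n - {base X3 n}" for \<sigma>
  proof -
    from Box[OF that] obtain a b c d where "\<sigma> = Box a b c d" "n = a + b + c + d + 3" by blast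
    then show ?thesis
      unfolding triple_of_simplex_def by (simp only: simplex3.case simplex_of_triple_Box)
  qed
qed

lemma simplex_of_triple_in: "simplex_of_triple n \<in> z_plus n \<rightarrow> simplices X3 n"
proof (rule funcsetI)
  fix p assume "p \<in> z_plus n"
  then consider "p \<in> y_plus n" | "p \<in> x_plus n" using z_plus_minus_y_plus by blast
  then show "simplex_of_triple n p \<in> simplices X3 n"
  proof cases
    case 2
    then show ?thesis by (rule x_plusE) (simp only: simplex_of_triple_Box, simp)
  qed (simp add: simplex_of_triple_Base)
qed

lemma simplex_of_triple_base_iff: "simplex_of_triple n p = base X3 n \<longleftrightarrow> p \<in> y_plus n"
  by (cases p) (simp add: simplex_of_triple_def)

text \<open>The top value relies on \<open>i \<le> n\<close>: then \<open>n + 1\<close> lies above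
  \<open>i\<close> and drops to \<open>n\<close>, the top value in degree
  \<open>n - 1\<close>.\<close>

lemma merge3_in_z_plus: "1 \<le> n \<Longrightarrow> i \<le> n \<Longrightarrow> merge3 i \<in> z_plus n \<rightarrow> z_plus (n - 1)"
  by (auto simp: z_plus_def merge3_def merge_def)

text \<open>Each way of lying in \<open>y_plus\<close> survives: 0 is fixed, \<open>n + 1\<close>
  goes to \<open>n\<close>, and equal entries stay equal.\<close>

lemma merge3_in_y_plus:
  assumes "1 \<le> n" "i \<le> n" "p \<in> y_plus n"
  shows "merge3 i p \<in> y_plus (n - 1)"
proof -
  have "merge3 i p \<in> z_plus (n - 1)"
    using merge3_in_z_plus[OF assms(1,2)] y_plus_subset assms(3) by auto
  then show ?thesis
    using assms by (cases p) (auto simp: y_plus_def merge3_def merge_def)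
qed

lemma sface_X3_in: "1 \<le> n \<Longrightarrow> i \<le> n \<Longrightarrow> sface X3 n i \<in> simplices X3 n \<rightarrow> simplices X3 (n - 1)"
  by (rule funcsetI, rename_tac \<sigma>, case_tac \<sigma>) (auto simp: X3_face_def)

lemma sface_X3_base: "sface X3 n i (base X3 n) = base X3 (n - 1)"
  by (simp add: X3_face_def)

text \<open>Face \<open>i\<close> deletes the vertex in position \<open>i\<close>: later positions
  move down by one and the others stay, which is what \<open>merge i\<close> does to first
  occurrences. If the deleted vertex was the only copy of its kind, the new triple falls into
  \<open>y_plus (n - 1)\<close> and both sides are the base point.\<close>

lemma simplex_of_triple_merge3:
  assumes "1 \<le> n" "i \<le> n" "p \<in> z_plus n"
  shows "simplex_of_triple (n - 1) (merge3 i p) = sface X3 n i (simplex_of_triple n p)"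
proof (cases "p \<in> y_plus n")
  case True
  then show ?thesis
    by (simp only: X3_simps X3_face_def simplex3.case simplex_of_triple_Base
        merge3_in_y_plus[OF assms(1,2)])
next
  case False
  then have "p \<in> x_plus n" using assms(3) z_plus_minus_y_plus by blast
  then obtain a b c d where p: "p = (a + 1, a + b + 2, a + b + c + 3)" and n: "n = a + b + c + d + 3"
    by (rule x_plusE)
  have box: "simplex_of_triple n p = Box a b c d"
    unfolding p by (rule simplex_of_triple_Box[OF n])
  \<comment> \<open>The cases tell which of the vertices 0, 1, 2, 3 stands in position
    \<open>i\<close>. When its last copy disappears, the merged triple has, respectively, first
    entry 0, first two entries equal, last two entries equal, or last entry \<open>n\<close>, the
    top value in degree \<open>n - 1\<close>.\<close>
  consider (a) "i \<le> a" | (b) "a < i" "i \<le> a + b + 1" | (c) "a + b + 1 < i" "i \<le> a + b + c + 2"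
    | (d) "a + b + c + 2 < i" by linarith
  then show ?thesis
  proof cases
    case a
    then have "merge3 i p = (a, a + b + 1, a + b + c + 2)" by (simp add: p merge3_def merge_def)
    then show ?thesis
      using a unfolding box by (cases a) (auto simp: n X3_face_def simplex_of_triple_def y_plus_def z_plus_def)
  next
    case b
    then have "merge3 i p = (a + 1, a + b + 1, a + b + c + 2)" by (simp add: p merge3_def merge_def)
    then show ?thesis
      using b unfolding box by (cases b) (auto simp: n X3_face_def simplex_of_triple_def y_plus_def z_plus_def)
  next
    case c
    then have "merge3 i p = (a + 1, a + b + 2, a + b + c + 2)" by (simp add: p merge3_def merge_def)
    then show ?thesis
      using c unfolding box by (cases c) (auto simp: n X3_face_def simplex_of_triple_def y_plus_def z_plus_def)
  next
    case d
    then have "merge3 i p = (a + 1, a + b + 2, a + b + c + 3)" by (simp add: p merge3_def merge_def)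
    then show ?thesis
      using d unfolding box by (cases d) (auto simp: n X3_face_def simplex_of_triple_def y_plus_def z_plus_def)
  qed
qed

section \<open>Comparison of the two complexes\<close>

lemma (in loday_coefficients) collapse_X3:
  "collapse k A M ra (z_plus n) (y_plus n) (simplices X3 n) (base X3 n) (simplex_of_triple n)"
proof unfold_locales
  show "base X3 n \<in> simplices X3 n" by simp
qed (simp_all only: finite_z_plus finite_simplices_X3 y_plus_subset simplex_of_triple_in
    simplex_of_triple_base_iff simplex_of_triple_bij)

lemma (in loday_coefficients) homology_tensor_iso_hochschild:
  "isomorphic_modules k (homology k (presimplicial_tensor k (A3 k A) (M3 k A M ra) (B3 k A)) n)
    (higher_hochschild_homology k A M ra X3 n)"
proof -
  let ?C = "presimplicial_tensor k (A3 k A) (M3 k A M ra) (B3 k A)"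
  let ?D = "hochschild_complex k A M ra X3"
  let ?f = "\<lambda>n. to_loday (z_plus n) (simplices X3 n) (base X3 n) (simplex_of_triple n)"
  have ract: "ract (M3 k A M ra) n = power_ract (y_plus n)" for n
    by (simp add: M3_def power_ract_def fun_eq_iff)
  have lact: "lact (B3 k A) n = power_lact (y_plus n) (z_plus n)" for n
    by (simp add: B3_def power_lact_def fun_eq_iff)
  have objs: "obj (A3 k A) n = tpow k A (y_plus n)" "obj (M3 k A M ra) n = M"
    "obj (B3 k A) n = tpow k A (z_plus n)" for n
    by (simp_all add: A3_def M3_def B3_def)
  have faces: "face (M3 k A M ra) n i = (\<lambda>m. m)"
    "face (B3 k A) n i = tpow_map k A (z_plus n) (z_plus (n - 1)) (merge3 i)" for n i
    by (simp_all add: M3_def B3_def fun_eq_iff)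
  have objC: "obj ?C n = power_tensor (y_plus n) (z_plus n)" for n
    by (simp add: presimplicial_tensor_def Let_def ract lact objs)
  have faceC: "face ?C n i = lift k (power_tensor (y_plus (n - 1)) (z_plus (n - 1)))
      (\<lambda>(m, t). power_tensor_elem (y_plus (n - 1)) (z_plus (n - 1)) m
        (tpow_map k A (z_plus n) (z_plus (n - 1)) (merge3 i) t))" for n i
    by (simp add: presimplicial_tensor_def Let_def ract lact objs faces)
  have objD: "obj ?D n = loday k A M (simplices X3 n) (base X3 n)" for n
    by (simp add: hochschild_complex_def)
  have faceD: "face ?D n i = loday_map k A M ra (simplices X3 n) (base X3 n)
      (simplices X3 (n - 1)) (base X3 (n - 1)) (sface X3 n i)" for n i
    by (simp add: hochschild_complex_def)
  \<comment> \<open>The assumptions of the naturality square, in order, with degree \<open>n\<close>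
    as source and degree \<open>n - 1\<close> as target.\<close>
  note square = collapse_X3 collapse_X3 merge3_in_z_plus sface_X3_in sface_X3_base simplex_of_triple_merge3
  have "isomorphic_modules k (homology k ?C n) (homology k ?D n)"
  proof (rule homology_isomorphic[where f = ?f])
    fix m i x assume i: "1 \<le> m" "i \<le> m" and x: "x \<in> carrier (obj ?C m)"
    show "face ?C m i x \<in> carrier (obj ?C (m - 1))"
      unfolding objC faceC
      by (rule module_hom_closed[OF power_face_hom[OF square]]) (use i x in \<open>simp_all add: objC\<close>)
    show "?f (m - 1) (face ?C m i x) = face ?D m i (?f m x)"
      unfolding faceC faceD
      by (rule to_loday_power_face[OF square]) (use i x in \<open>simp_all add: objC\<close>)
  qed (simp_all only: objC objD loday_is_module collapse.L_is_module[OF collapse_X3]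
      collapse.to_loday_hom[OF collapse_X3] collapse.to_loday_bij[OF collapse_X3])
  then show ?thesis by (simp only: higher_hochschild_homology_def)
qed

theorem theorem3p16:
  fixes k :: "('k, 'w) ring_scheme"
    and A :: "('k, 'a, 'z) module_scheme"
    and M :: "('k, 'm) module"
    and la :: "'a \<Rightarrow> 'm \<Rightarrow> 'm"
    and ra :: "'m \<Rightarrow> 'a \<Rightarrow> 'm"
  assumes "field k"
    and "algebra k A"
    and "symmetric_bimodule k A M la ra"
  shows "\<forall>n. isomorphic_modules k
           (homology k (presimplicial_tensor k (A3 k A) (M3 k A M ra) (B3 k A)) n)
           (higher_hochschild_homology k A M ra X3 n)"
proof
  fix n
  have "module k M" "right_action k A M ra"
    using assms(3) by (auto simp: symmetric_bimodule_def bimodule_def)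
  then have "loday_coefficients k A M ra"
    using assms(2)
    by (intro loday_coefficients.intro tensor_powers.intro loday_coefficients_axioms.intro)
  from loday_coefficients.homology_tensor_iso_hochschild[OF this]
  show "isomorphic_modules k
      (homology k (presimplicial_tensor k (A3 k A) (M3 k A M ra) (B3 k A)) n)
      (higher_hochschild_homology k A M ra X3 n)" .
qed

end
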